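(* Let $R(z)$ be given by a stable representation $$R(z)=\delta+z\gamma_+(I_{\mathcal X_+}-z\alpha_+)^{-1}\beta_+ + \gamma_-(zI_{\mathcal X_-}-\alpha_-)^{-1}\beta_-,$$ and assume that $R(z)$ is analytic and invertible in an open neighborhood of the unit circle $\mathbb T$. Then the following hold. The function $R(z)$ admits a right canonical Wiener-Hopf factorization if and only if there exists a $Q\in\mathcal B(\mathcal X_+,\mathcal X_-)$ such that $\delta-\gamma_-Q\beta_+$ is invertible, which satisfies the algebraic Riccati equation $$Q=\alpha_-Q\alpha_++(\beta_--\alpha_-Q\beta_+)(\delta-\gamma_-Q\beta_+)^{-1}(\gamma_+-\gamma_-Q\alpha_+),$$ and which is stabilizing in the sense that the operators $$\alpha_+^\circ:=\alpha_+-\beta_+(\delta-\gamma_-Q\beta_+)^{-1}(\gamma_+-\gamma_-Q\alpha_+),\qquad \alpha_-^\circ:=\alpha_--(\beta_--\alpha_-Q\beta_+)(\delta-\gamma_-Q\beta_+)^{-1}\gamma_-$$ are both exponentially stable. Moreover, there exists at most one stabilizing solution $Q$ to the Riccati equation. If $Q$ is a stabilizing solution, then a right canonical Wiener-Hopf factorization $R(z)=V_-(z)V_+(z)$ is given by $$V_-(z):=\delta_-+\gamma_-(zI_{\mathcal X_-}-\alpha_-)^{-1}\beta_-^\circ,\qquad V_+(z):=\delta_++z\gamma_+^\circ(I_{\mathcal X_+}-z\alpha_+)^{-1}\beta_+,$$ where $\delta_+,\delta_-\in\mathcal B(\mathcal U)$ are invertible operators such that $\delta_-\delta_+=\delta-\gamma_-Q\beta_+$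 and $$\gamma_+^\circ:=\delta_-^{-1}(\gamma_+-\gamma_-Q\alpha_+),\qquad \beta_-^\circ:=(\beta_--\alpha_-Q\beta_+)\delta_+^{-1}.$$ In that case, the inverses of $V_+(z)$ and $V_-(z)$ are given by $$V_+(z)^{-1}=\delta_+^{-1}-z\delta_+^{-1}\gamma_+^\circ(I_{\mathcal X_+}-z\alpha_+^\circ)^{-1}\beta_+\delta_+^{-1},$$ $$V_-(z)^{-1}=\delta_-^{-1}-\delta_-^{-1}\gamma_-(zI_{\mathcal X_-}-\alpha_-^\circ)^{-1}\beta_-^\circ\delta_-^{-1}.$$
   Context: $\mathbb D$ is the open unit disc, $\mathbb T$ the unit circle. $\mathcal B(\mathcal X,\mathcal Y)$ denotes the bounded linear operators between Hilbert spaces $\mathcal X$ and $\mathcal Y$, and $\mathcal B(\mathcal X)=\mathcal B(\mathcal X,\mathcal X)$. "Operator" means bounded linear operator and "invertible" means boundedly invertible. An operator $T$ is exponentially stable if $\sigma(T)\subset\mathbb D$. A stable representation of a $\mathcal B(\mathcal U)$-valued function $R$ is a formula $R(z)=\delta+z\gamma_+(I_{\mathcal X_+}-z\alpha_+)^{-1}\beta_++\gamma_-(zI_{\mathcal X_-}-\alpha_-)^{-1}\beta_-$, where $\mathcal U,\mathcal X_+,\mathcal X_-$ are complex Hilbert spaces (possibly infinite dimensional), $\delta\in\mathcal B(\mathcal U)$, $\alpha_\pm\in\mathcal B(\mathcal X_\pm)$, $\beta_\pm\in\mathcal B(\mathcal U,\mathcal X_\pm)$, $\gamma_\pm\in\mathcal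 B(\mathcal X_\pm,\mathcal U)$, and $\alpha_+$, $\alpha_-$ are both exponentially stable. A right canonical Wiener-Hopf factorization of $R$ is a factorization $R(z)=V_-(z)V_+(z)$ for $z\in\mathbb T$, with $\mathcal B(\mathcal U)$-valued $V_\pm$, such that $V_+$ is analytic with invertible values on (a neighborhood of) $\overline{\mathbb D}$, with inverse also analytic there, and $V_-$ is analytic with invertible values on (a neighborhood of) $(\mathbb C\setminus\mathbb D)\cup\{\infty\}$, with inverse also analytic there. *)

theory Defs
  imports "HOL-Analysis.Analysis"
begin

section \<open>Complex Hilbert spaces\<close>

class complex_vector = real_vector +
  fixes scaleC :: "complex \<Rightarrow> 'a \<Rightarrow> 'a"  (infixr "*\<^sub>C" 75)
  assumes scaleC_add_right: "c *\<^sub>C (x + y) = c *\<^sub>C x + c *\<^sub>C y"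
    and scaleC_add_left: "(c + d) *\<^sub>C x = c *\<^sub>C x + d *\<^sub>C x"
    and scaleC_scaleC: "c *\<^sub>C (d *\<^sub>C x) = (c * d) *\<^sub>C x"
    and scaleC_one: "1 *\<^sub>C x = x"
    and scaleR_scaleC: "r *\<^sub>R x = complex_of_real r *\<^sub>C x"

class complex_normed_vector = complex_vector + real_normed_vector +
  assumes norm_scaleC: "norm (c *\<^sub>C x) = cmod c * norm x"

text \<open>The inner product is linear in the first argument. The last axiom contains positive
  definiteness and the fact that the given norm is the Hilbert space norm. The zero space is a
  legitimate instance.\<close>

class complex_hilbert = complex_normed_vector + complete_space +
  fixes cinner :: "'a \<Rightarrow> 'a \<Rightarrow> complex"
  assumes cinner_commute: "cinner x y = cnj (cinner y x)"
    and cinner_add_left: "cinner (x + y) z = cinner x z + cinner y z"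
    and cinner_scaleC_left: "cinner (c *\<^sub>C x) y = c * cinner x y"
    and cinner_self: "cinner x x = complex_of_real ((norm x)\<^sup>2)"

instantiation complex :: complex_hilbert
begin

definition "scaleC (c::complex) (x::complex) = c * x"
definition "cinner (x::complex) (y::complex) = x * cnj y"

instance
proof
  fix x y z c d :: complex and r :: real
  show "c *\<^sub>C (x + y) = c *\<^sub>C x + c *\<^sub>C y" "(c + d) *\<^sub>C x = c *\<^sub>C x + d *\<^sub>C x"
    "c *\<^sub>C (d *\<^sub>C x) = (c * d) *\<^sub>C x" "1 *\<^sub>C x = x"
    by (simp_all add: scaleC_complex_def distrib_left distrib_right mult.assoc)
  show "r *\<^sub>R x = complex_of_real r *\<^sub>C x"
    by (simp add: scaleC_complex_def scaleR_conv_of_real)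
  show "norm (c *\<^sub>C x) = cmod c * norm x"
    by (simp add: scaleC_complex_def norm_mult)
  show "cinner x y = cnj (cinner y x)"
    by (simp add: cinner_complex_def mult.commute)
  show "cinner (x + y) z = cinner x z + cinner y z" "cinner (c *\<^sub>C x) y = c * cinner x y"
    by (simp_all add: cinner_complex_def scaleC_complex_def distrib_right mult.assoc)
  show "cinner x x = complex_of_real ((norm x)\<^sup>2)"
    unfolding cinner_complex_def by (rule complex_norm_square[symmetric])
qed

end


lemma scaleC_zero_right [simp]: "c *\<^sub>C (0::'a::complex_vector) = 0"
  using scaleC_add_right[of c 0 "0::'a"] by simp

lemma scaleC_minus_right: "c *\<^sub>C (- x) = - (c *\<^sub>C (x::'a::complex_vector))"
proof -
  have "c *\<^sub>C x + c *\<^sub>C (- x) = 0"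
    by (simp add: scaleC_add_right[symmetric])
  then show ?thesis by (simp add: add_eq_0_iff)
qed

lemma scaleC_diff_right: "c *\<^sub>C (x - y) = c *\<^sub>C x - c *\<^sub>C (y::'a::complex_vector)"
  unfolding diff_conv_add_uminus scaleC_add_right scaleC_minus_right ..

lemma scaleC_scaleR_commute: "c *\<^sub>C (r *\<^sub>R x) = r *\<^sub>R (c *\<^sub>C (x::'a::complex_vector))"
  by (simp add: scaleR_scaleC scaleC_scaleC mult.commute)

lemma bounded_linear_scaleC: "bounded_linear (\<lambda>x::'a::complex_normed_vector. c *\<^sub>C x)"
  by (rule bounded_linear_intro[where K = "cmod c"])
    (simp_all add: scaleC_add_right scaleC_scaleR_commute norm_scaleC mult.commute)


section \<open>Bounded complex-linear operators\<close>

text \<open>The library type of bounded operators consists of the real-linear ones. The complex-linear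
  ones form a subspace, which carries the same operator norm.\<close>

typedef (overloaded) ('a, 'b) cop =
  "{F :: 'a::complex_normed_vector \<Rightarrow>\<^sub>L 'b::complex_normed_vector.
      \<forall>c x. blinfun_apply F (c *\<^sub>C x) = c *\<^sub>C blinfun_apply F x}"
  by (rule exI[of _ 0]) simp

setup_lifting type_definition_cop

lift_definition cop_apply :: "('a::complex_normed_vector, 'b::complex_normed_vector) cop \<Rightarrow> 'a \<Rightarrow> 'b"
  is blinfun_apply .

lift_definition cop_id :: "('a::complex_normed_vector, 'a) cop" is id_blinfun
  by simp

lift_definition cop_compose ::
  "('b::complex_normed_vector, 'c::complex_normed_vector) cop \<Rightarrow>
   ('a::complex_normed_vector, 'b) cop \<Rightarrow> ('a, 'c) cop"  (infixl "\<cdot>" 70)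
  is blinfun_compose
  by simp

lift_definition blinfun_scaleC ::
    "complex \<Rightarrow> 'a::complex_normed_vector \<Rightarrow>\<^sub>L 'a"
  is "\<lambda>c x. c *\<^sub>C x"
  by (rule bounded_linear_scaleC)

instantiation cop :: (complex_normed_vector, complex_normed_vector) complex_normed_vector
begin

lift_definition zero_cop :: "('a, 'b) cop" is 0
  by simp

lift_definition plus_cop :: "('a, 'b) cop \<Rightarrow> ('a, 'b) cop \<Rightarrow> ('a, 'b) cop" is "(+)"
  by (simp add: blinfun.add_left scaleC_add_right)

lift_definition minus_cop :: "('a, 'b) cop \<Rightarrow> ('a, 'b) cop \<Rightarrow> ('a, 'b) cop" is "(-)"
  by (simp add: blinfun.diff_left scaleC_diff_right)

lift_definition uminus_cop :: "('a, 'b) cop \<Rightarrow> ('a, 'b) cop" is uminus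
  by (simp add: blinfun.minus_left scaleC_minus_right)

lift_definition scaleR_cop :: "real \<Rightarrow> ('a, 'b) cop \<Rightarrow> ('a, 'b) cop" is "(*\<^sub>R)"
  by (simp add: blinfun.scaleR_left scaleC_scaleR_commute)

lift_definition scaleC_cop :: "complex \<Rightarrow> ('a, 'b) cop \<Rightarrow> ('a, 'b) cop"
  is "\<lambda>c F. blinfun_scaleC c o\<^sub>L F"
  by (simp add: blinfun_scaleC.rep_eq scaleC_scaleC mult.commute)

lift_definition norm_cop :: "('a, 'b) cop \<Rightarrow> real" is norm .

definition dist_cop :: "('a, 'b) cop \<Rightarrow> ('a, 'b) cop \<Rightarrow> real"
  where "dist_cop F G = norm (F - G)"

definition sgn_cop :: "('a, 'b) cop \<Rightarrow> ('a, 'b) cop"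
  where "sgn_cop F = inverse (norm F) *\<^sub>R F"

definition uniformity_cop :: "(('a, 'b) cop \<times> ('a, 'b) cop) filter"
  where "uniformity_cop = (INF e\<in>{0<..}. principal {(F, G). dist F G < e})"

definition open_cop :: "('a, 'b) cop set \<Rightarrow> bool"
  where "open_cop S = (\<forall>F\<in>S. \<forall>\<^sub>F (F', G) in uniformity. F' = F \<longrightarrow> G \<in> S)"

instance
proof
  fix F G H :: "('a, 'b) cop" and c d :: complex and r s :: real
  show "F + G + H = F + (G + H)" by transfer simp
  show "F + G = G + F" by transfer simp
  show "0 + F = F" by transfer simp
  show "- F + F = 0" by transfer simp
  show "F - G = F + - G" by transfer simp
  show "r *\<^sub>R (F + G) = r *\<^sub>R F + r *\<^sub>R G" by transfer (simp add: scaleR_add_right)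
  show "(r + s) *\<^sub>R F = r *\<^sub>R F + s *\<^sub>R F" by transfer (simp add: scaleR_add_left)
  show "r *\<^sub>R s *\<^sub>R F = (r * s) *\<^sub>R F" by transfer simp
  show "1 *\<^sub>R F = F" by transfer simp
  show "c *\<^sub>C (F + G) = c *\<^sub>C F + c *\<^sub>C G"
    by transfer (rule blinfun_eqI,
      simp add: blinfun.add_left blinfun_scaleC.rep_eq scaleC_add_right)
  show "(c + d) *\<^sub>C F = c *\<^sub>C F + d *\<^sub>C F"
    by transfer (rule blinfun_eqI,
      simp add: blinfun.add_left blinfun_scaleC.rep_eq scaleC_add_left)
  show "c *\<^sub>C (d *\<^sub>C F) = (c * d) *\<^sub>C F"
    by transfer (rule blinfun_eqI, simp add: blinfun_scaleC.rep_eq scaleC_scaleC)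
  show "1 *\<^sub>C F = F"
    by transfer (rule blinfun_eqI, simp add: blinfun_scaleC.rep_eq scaleC_one)
  show "r *\<^sub>R F = complex_of_real r *\<^sub>C F"
    by transfer (rule blinfun_eqI,
      simp add: blinfun.scaleR_left blinfun_scaleC.rep_eq scaleR_scaleC)
  show "dist F G = norm (F - G)" by (rule dist_cop_def)
  show "sgn F = inverse (norm F) *\<^sub>R F" by (rule sgn_cop_def)
  show "uniformity = (INF e\<in>{0<..}. principal {(F::('a, 'b) cop, G). dist F G < e})"
    by (rule uniformity_cop_def)
  show "open S = (\<forall>F\<in>S. \<forall>\<^sub>F (F', G) in uniformity. F' = F \<longrightarrow> G \<in> S)"
    for S :: "('a, 'b) cop set"
    by (rule open_cop_def)
  show "norm F = 0 \<longleftrightarrow> F = 0" by transfer simp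
  show "norm (F + G) \<le> norm F + norm G" by transfer (rule norm_triangle_ineq)
  show "norm (r *\<^sub>R F) = \<bar>r\<bar> * norm F" by transfer simp
  show "norm (c *\<^sub>C F) = cmod c * norm F"
  proof transfer
    fix c and F :: "'a \<Rightarrow>\<^sub>L 'b"
    have le: "norm (blinfun_scaleC a o\<^sub>L K) \<le> cmod a * norm K" for a and K :: "'a \<Rightarrow>\<^sub>L 'b"
      by (rule norm_blinfun_bound)
        (simp_all add: blinfun_scaleC.rep_eq norm_scaleC mult.assoc mult_left_mono norm_blinfun)
    show "norm (blinfun_scaleC c o\<^sub>L F) = cmod c * norm F"
    proof (cases "c = 0")
      case True
      then show ?thesis using le[of c F] by simp
    next
      case False
      have "blinfun_scaleC (inverse c) o\<^sub>L (blinfun_scaleC c o\<^sub>L F) = F"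
        using False
        by (intro blinfun_eqI) (simp add: blinfun_scaleC.rep_eq scaleC_scaleC scaleC_one)
      then have "norm F \<le> cmod (inverse c) * norm (blinfun_scaleC c o\<^sub>L F)"
        using le[of "inverse c" "blinfun_scaleC c o\<^sub>L F"] by simp
      then have "cmod c * norm F \<le> norm (blinfun_scaleC c o\<^sub>L F)"
        using False by (simp add: norm_divide field_simps)
      then show ?thesis using le[of c F] by simp
    qed
  qed
qed

end

lemma cop_apply_scaleC: "cop_apply (c *\<^sub>C F) x = c *\<^sub>C cop_apply F x"
  by transfer (simp add: blinfun_scaleC.rep_eq)

definition cop_invertible :: "('a::complex_normed_vector, 'b::complex_normed_vector) cop \<Rightarrow> bool"
  where "cop_invertible T \<longleftrightarrow> (\<exists>S. S \<cdot> T = cop_id \<and> T \<cdot> S = cop_id)"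

text \<open>Only meaningful for invertible operators.\<close>

definition cop_inv ::
  "('a::complex_normed_vector, 'b::complex_normed_vector) cop \<Rightarrow> ('b, 'a) cop"
  where "cop_inv T = (THE S. S \<cdot> T = cop_id \<and> T \<cdot> S = cop_id)"

definition cop_spectrum :: "('a::complex_normed_vector, 'a) cop \<Rightarrow> complex set"
  where "cop_spectrum T = {z. \<not> cop_invertible (z *\<^sub>C cop_id - T)}"

definition exponentially_stable :: "('a::complex_normed_vector, 'a) cop \<Rightarrow> bool"
  where "exponentially_stable T \<longleftrightarrow> cop_spectrum T \<subseteq> ball 0 1"


section \<open>Vector-valued analytic functions\<close>

text \<open>Complex differentiability in norm at every point of \<open>S\<close>; the limits are over full
  neighbourhoods, and the notion is used for open \<open>S\<close> only.\<close>

definition vec_analytic_on :: "(complex \<Rightarrow> 'a::complex_normed_vector) \<Rightarrow> complex set \<Rightarrow> bool"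
  where "vec_analytic_on F S \<longleftrightarrow>
    (\<forall>z\<in>S. \<exists>D. ((\<lambda>w. (1 / (w - z)) *\<^sub>C (F w - F z)) \<longlongrightarrow> D) (at z))"

text \<open>Analyticity in a neighbourhood of infinity of \<open>F\<close>, extended by the value \<open>L\<close> at infinity.\<close>

definition vec_analytic_at_infinity :: "(complex \<Rightarrow> 'a::complex_normed_vector) \<Rightarrow> 'a \<Rightarrow> bool"
  where "vec_analytic_at_infinity F L \<longleftrightarrow>
    (\<exists>r>0. vec_analytic_on (\<lambda>w. if w = 0 then L else F (1 / w)) (ball 0 r))"


section \<open>Wiener-Hopf factorization, stable representations, Riccati equation\<close>

definition right_canonical_factorization ::
  "(complex \<Rightarrow> ('u::complex_normed_vector, 'u) cop) \<Rightarrow>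
   (complex \<Rightarrow> ('u, 'u) cop) \<Rightarrow> (complex \<Rightarrow> ('u, 'u) cop) \<Rightarrow> bool"
  where "right_canonical_factorization R V\<^sub>m V\<^sub>p \<longleftrightarrow>
    (\<forall>z\<in>sphere 0 1. R z = V\<^sub>m z \<cdot> V\<^sub>p z) \<and>
    (\<exists>\<Omega>. open \<Omega> \<and> cball 0 1 \<subseteq> \<Omega> \<and>
       vec_analytic_on V\<^sub>p \<Omega> \<and> (\<forall>z\<in>\<Omega>. cop_invertible (V\<^sub>p z)) \<and>
       vec_analytic_on (\<lambda>z. cop_inv (V\<^sub>p z)) \<Omega>) \<and>
    (\<exists>\<Omega> L. open \<Omega> \<and> - ball 0 1 \<subseteq> \<Omega> \<and>
       vec_analytic_on V\<^sub>m \<Omega> \<and> (\<forall>z\<in>\<Omega>. cop_invertible (V\<^sub>m z)) \<and>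
       vec_analytic_on (\<lambda>z. cop_inv (V\<^sub>m z)) \<Omega> \<and>
       vec_analytic_at_infinity V\<^sub>m L \<and> cop_invertible L \<and>
       vec_analytic_at_infinity (\<lambda>z. cop_inv (V\<^sub>m z)) (cop_inv L))"

text \<open>\<open>R\<close> is only prescribed where both inverses in the formula exist; by stability this is an open
  set containing the unit circle.\<close>

definition stable_representation ::
  "(complex \<Rightarrow> ('u::complex_hilbert, 'u) cop) \<Rightarrow> ('u, 'u) cop \<Rightarrow>
   ('x::complex_hilbert, 'x) cop \<Rightarrow> ('u, 'x) cop \<Rightarrow> ('x, 'u) cop \<Rightarrow>
   ('y::complex_hilbert, 'y) cop \<Rightarrow> ('u, 'y) cop \<Rightarrow> ('y, 'u) cop \<Rightarrow> bool"
  where "stable_representation R \<delta> \<alpha>\<^sub>p \<beta>\<^sub>p \<gamma>\<^sub>p \<alpha>\<^sub>m \<beta>\<^sub>m \<gamma>\<^sub>m \<longleftrightarrow>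
    exponentially_stable \<alpha>\<^sub>p \<and> exponentially_stable \<alpha>\<^sub>m \<and>
    (\<forall>z. cop_invertible (cop_id - z *\<^sub>C \<alpha>\<^sub>p) \<and> cop_invertible (z *\<^sub>C cop_id - \<alpha>\<^sub>m) \<longrightarrow>
       R z = \<delta> + z *\<^sub>C (\<gamma>\<^sub>p \<cdot> cop_inv (cop_id - z *\<^sub>C \<alpha>\<^sub>p) \<cdot> \<beta>\<^sub>p)
               + \<gamma>\<^sub>m \<cdot> cop_inv (z *\<^sub>C cop_id - \<alpha>\<^sub>m) \<cdot> \<beta>\<^sub>m)"

definition alpha_circ_plus ::
  "('u::complex_hilbert, 'u) cop \<Rightarrow>
   ('x::complex_hilbert, 'x) cop \<Rightarrow> ('u, 'x) cop \<Rightarrow> ('x, 'u) cop \<Rightarrow>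
   ('y::complex_hilbert, 'u) cop \<Rightarrow> ('x, 'y) cop \<Rightarrow> ('x, 'x) cop"
  where "alpha_circ_plus \<delta> \<alpha>\<^sub>p \<beta>\<^sub>p \<gamma>\<^sub>p \<gamma>\<^sub>m Q =
    \<alpha>\<^sub>p - \<beta>\<^sub>p \<cdot> cop_inv (\<delta> - \<gamma>\<^sub>m \<cdot> Q \<cdot> \<beta>\<^sub>p) \<cdot> (\<gamma>\<^sub>p - \<gamma>\<^sub>m \<cdot> Q \<cdot> \<alpha>\<^sub>p)"

definition alpha_circ_minus ::
  "('u::complex_hilbert, 'u) cop \<Rightarrow> ('u, 'x::complex_hilbert) cop \<Rightarrow>
   ('y::complex_hilbert, 'y) cop \<Rightarrow> ('u, 'y) cop \<Rightarrow> ('y, 'u) cop \<Rightarrow>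
   ('x, 'y) cop \<Rightarrow> ('y, 'y) cop"
  where "alpha_circ_minus \<delta> \<beta>\<^sub>p \<alpha>\<^sub>m \<beta>\<^sub>m \<gamma>\<^sub>m Q =
    \<alpha>\<^sub>m - (\<beta>\<^sub>m - \<alpha>\<^sub>m \<cdot> Q \<cdot> \<beta>\<^sub>p) \<cdot> cop_inv (\<delta> - \<gamma>\<^sub>m \<cdot> Q \<cdot> \<beta>\<^sub>p) \<cdot> \<gamma>\<^sub>m"

definition stabilizing_solution ::
  "('u::complex_hilbert, 'u) cop \<Rightarrow>
   ('x::complex_hilbert, 'x) cop \<Rightarrow> ('u, 'x) cop \<Rightarrow> ('x, 'u) cop \<Rightarrow>
   ('y::complex_hilbert, 'y) cop \<Rightarrow> ('u, 'y) cop \<Rightarrow> ('y, 'u) cop \<Rightarrow>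
   ('x, 'y) cop \<Rightarrow> bool"
  where "stabilizing_solution \<delta> \<alpha>\<^sub>p \<beta>\<^sub>p \<gamma>\<^sub>p \<alpha>\<^sub>m \<beta>\<^sub>m \<gamma>\<^sub>m Q \<longleftrightarrow>
    cop_invertible (\<delta> - \<gamma>\<^sub>m \<cdot> Q \<cdot> \<beta>\<^sub>p) \<and>
    Q = \<alpha>\<^sub>m \<cdot> Q \<cdot> \<alpha>\<^sub>p
        + (\<beta>\<^sub>m - \<alpha>\<^sub>m \<cdot> Q \<cdot> \<beta>\<^sub>p) \<cdot> cop_inv (\<delta> - \<gamma>\<^sub>m \<cdot> Q \<cdot> \<beta>\<^sub>p) \<cdot> (\<gamma>\<^sub>p - \<gamma>\<^sub>m \<cdot> Q \<cdot> \<alpha>\<^sub>p) \<and>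
    exponentially_stable (alpha_circ_plus \<delta> \<alpha>\<^sub>p \<beta>\<^sub>p \<gamma>\<^sub>p \<gamma>\<^sub>m Q) \<and>
    exponentially_stable (alpha_circ_minus \<delta> \<beta>\<^sub>p \<alpha>\<^sub>m \<beta>\<^sub>m \<gamma>\<^sub>m Q)"

end

theory Submission
  imports Defs "HOL-Complex_Analysis.Complex_Analysis"
begin

text \<open>Write \<open>w = 1 / z\<close>, so that a function that is analytic outside the disc and at infinity becomes
  a function of \<open>w\<close> that is analytic on the closed unit disc. The indices \<open>+\<close> and \<open>-\<close> below appear as
  \<open>p\<close> and \<open>m\<close> in the formulas.

  If \<open>Q\<close> is a stabilizing solution, then \<open>\<beta>\<^sub>-\<^sup>\<circ> \<gamma>\<^sub>+\<^sup>\<circ> = Q - \<alpha>\<^sub>- Q \<alpha>\<^sub>+\<close> by the Riccati equation, and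
  expanding \<open>V\<^sub>-(z) V\<^sub>+(z)\<close> with the help of \<open>resolvent_product_split\<close> gives back the representation of
  \<open>R\<close>. By the Woodbury identity the operators \<open>\<alpha>\<^sub>+\<^sup>\<circ>\<close> and \<open>\<alpha>\<^sub>-\<^sup>\<circ>\<close> are the state operators of \<open>V\<^sub>+\<^sup>-\<^sup>1\<close> and
  \<open>V\<^sub>-\<^sup>-\<^sup>1\<close>, so their stability makes the factors invertible where they have to be. Two stabilizing
  solutions differ by a solution of \<open>D = A D B\<close> with \<open>A\<close> and \<open>B\<close> exponentially stable, so
  \<open>D = A\<^sup>n D B\<^sup>n\<close> tends to \<open>0\<close>.

  Conversely, let \<open>R = V\<^sub>- V\<^sub>+\<close> be a canonical factorization. As the representation of \<open>R\<close> need not be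
  minimal, comparing transfer functions does not determine \<open>Q\<close>, which is constructed from the factors
  instead. Expanding \<open>V\<^sub>-(z)\<^sup>-\<^sup>1 = \<Sum>k. w\<^sup>k b\<^sub>k\<close>, put \<open>C = \<Sum>k. b\<^sub>k \<gamma>\<^sub>+ \<alpha>\<^sub>+\<^sup>k\<close>. Division with remainder
  (\<open>disc_analytic_right_division\<close>) gives \<open>V\<^sub>-(z)\<^sup>-\<^sup>1 \<gamma>\<^sub>+ = C + E(w) (w - \<alpha>\<^sub>+)\<close> with \<open>E\<close> analytic on the
  closed disc. Three applications of Liouville's theorem, in the form of
  \<open>disc_analytic_reflection_const\<close>, finish the proof:

  \<^item> \<open>V\<^sub>+ = V\<^sub>-\<^sup>-\<^sup>1 R\<close> on the circle shows that \<open>V\<^sub>+(z) - z C (I - z \<alpha>\<^sub>+)\<^sup>-\<^sup>1 \<beta>\<^sub>+\<close> is a constant \<open>\<delta>\<^sub>+\<close>. So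
    \<open>\<alpha>\<^sub>+\<^sup>\<circ> = \<alpha>\<^sub>+ - \<beta>\<^sub>+ \<delta>\<^sub>+\<^sup>-\<^sup>1 C\<close> is exponentially stable, and \<open>Q\<close> can be defined as a solution of the Stein
    equation \<open>Q = \<alpha>\<^sub>- Q \<alpha>\<^sub>+\<^sup>\<circ> + \<beta>\<^sub>- \<delta>\<^sub>+\<^sup>-\<^sup>1 C\<close>. With \<open>B = (\<beta>\<^sub>- - \<alpha>\<^sub>- Q \<beta>\<^sub>+) \<delta>\<^sub>+\<^sup>-\<^sup>1\<close> it reads
    \<open>Q - \<alpha>\<^sub>- Q \<alpha>\<^sub>+ = B C\<close>.

  \<^item> \<open>V\<^sub>- = R V\<^sub>+\<^sup>-\<^sup>1\<close> on the circle shows that \<open>V\<^sub>-(z) - \<gamma>\<^sub>- (z - \<alpha>\<^sub>-)\<^sup>-\<^sup>1 B\<close> is a constant \<open>\<delta>\<^sub>-\<close>, and that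
    \<open>\<delta>\<^sub>- \<delta>\<^sub>+ = \<delta> - \<gamma>\<^sub>- Q \<beta>\<^sub>+\<close>.

  \<^item> The defect \<open>K = \<gamma>\<^sub>+ - \<delta>\<^sub>- C - \<gamma>\<^sub>- Q \<alpha>\<^sub>+\<close> satisfies \<open>K (I - z \<alpha>\<^sub>+)\<^sup>-\<^sup>1 = w S(w)\<close> on the circle with \<open>S\<close>
    analytic on the closed disc. The common constant value of both sides is their value \<open>0\<close> at
    \<open>w = 0\<close>, so \<open>K = 0\<close>.

  The Stein equation for \<open>Q\<close> has now become the Riccati equation. The power series used here are
  Taylor series in operator norm, obtained from Cauchy's integral formula for the matrix
  coefficients. They also show that the powers of an exponentially stable operator decay
  geometrically.\<close>

instance complex_hilbert \<subseteq> banach ..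

section \<open>The algebra of bounded operators\<close>

lemma cop_eqI: "(\<And>x. cop_apply A x = cop_apply B x) \<Longrightarrow> A = B"
  by transfer (auto intro: blinfun_eqI)

lemma cop_apply_compose: "cop_apply (A \<cdot> B) x = cop_apply A (cop_apply B x)"
  by transfer simp

lemma cop_apply_add: "cop_apply (A + B) x = cop_apply A x + cop_apply B x"
  by transfer (simp add: blinfun.add_left)

lemma norm_cop_apply: "norm (cop_apply A x) \<le> norm A * norm x"
  by transfer (rule norm_blinfun)

lemma norm_cop_compose: "norm (A \<cdot> B) \<le> norm A * norm B"
  by transfer (rule norm_blinfun_compose)

lemma cop_compose_assoc: "(A \<cdot> B) \<cdot> C = A \<cdot> (B \<cdot> C)"
  by (rule cop_eqI) (simp add: cop_apply_compose)

lemma cop_compose_add_left: "(A + B) \<cdot> C = A \<cdot> C + B \<cdot> C"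
  by transfer (rule blinfun_eqI, simp add: blinfun.add_left)

lemma cop_compose_add_right: "A \<cdot> (B + C) = A \<cdot> B + A \<cdot> C"
  by transfer (rule blinfun_eqI, simp add: blinfun.add_left blinfun.add_right)

lemma cop_compose_scaleC_left: "(c *\<^sub>C A) \<cdot> B = c *\<^sub>C (A \<cdot> B)"
  by transfer (rule blinfun_eqI, simp add: blinfun_scaleC.rep_eq)

lemma cop_compose_scaleC_right: "A \<cdot> (c *\<^sub>C B) = c *\<^sub>C (A \<cdot> B)"
  by transfer (rule blinfun_eqI, simp add: blinfun_scaleC.rep_eq)

lemma cop_apply_id: "cop_apply cop_id x = x"
  by transfer simp

lemma cop_id_left [simp]: "cop_id \<cdot> A = A"
  by (rule cop_eqI) (simp add: cop_apply_compose cop_apply_id)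

lemma cop_id_right [simp]: "A \<cdot> cop_id = A"
  by (rule cop_eqI) (simp add: cop_apply_compose cop_apply_id)

lemma bounded_bilinear_cop_compose:
  "bounded_bilinear ((\<cdot>) :: ('b::complex_normed_vector, 'c::complex_normed_vector) cop \<Rightarrow>
     ('a::complex_normed_vector, 'b) cop \<Rightarrow> ('a, 'c) cop)"
proof
  fix A A' :: "('b, 'c) cop" and B B' :: "('a, 'b) cop" and r :: real
  show "(A + A') \<cdot> B = A \<cdot> B + A' \<cdot> B" by (rule cop_compose_add_left)
  show "A \<cdot> (B + B') = A \<cdot> B + A \<cdot> B'" by (rule cop_compose_add_right)
  show "(r *\<^sub>R A) \<cdot> B = r *\<^sub>R (A \<cdot> B)" "A \<cdot> (r *\<^sub>R B) = r *\<^sub>R (A \<cdot> B)"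
    by (simp_all add: scaleR_scaleC cop_compose_scaleC_left cop_compose_scaleC_right)
  show "\<exists>K. \<forall>(A :: ('b, 'c) cop) (B :: ('a, 'b) cop). norm (A \<cdot> B) \<le> norm A * norm B * K"
    by (rule exI[of _ 1]) (simp add: norm_cop_compose)
qed

interpretation cop_compose: bounded_bilinear
  "(\<cdot>) :: ('b::complex_normed_vector, 'c::complex_normed_vector) cop \<Rightarrow>
     ('a::complex_normed_vector, 'b) cop \<Rightarrow> ('a, 'c) cop"
  by (rule bounded_bilinear_cop_compose)

lemma bounded_bilinear_scaleC:
  "bounded_bilinear ((*\<^sub>C) :: complex \<Rightarrow> 'a \<Rightarrow> 'a::complex_normed_vector)"
proof
  fix c d :: complex and x y :: 'a and r :: real
  show "(c + d) *\<^sub>C x = c *\<^sub>C x + d *\<^sub>C x" by (rule scaleC_add_left)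
  show "c *\<^sub>C (x + y) = c *\<^sub>C x + c *\<^sub>C y" by (rule scaleC_add_right)
  show "(r *\<^sub>R c) *\<^sub>C x = r *\<^sub>R (c *\<^sub>C x)"
    by (simp add: scaleR_scaleC scaleC_scaleC scaleC_complex_def)
  show "c *\<^sub>C (r *\<^sub>R x) = r *\<^sub>R (c *\<^sub>C x)" by (rule scaleC_scaleR_commute)
  show "\<exists>K. \<forall>(c::complex) (x::'a). norm (c *\<^sub>C x) \<le> norm c * norm x * K"
    by (rule exI[of _ 1]) (simp add: norm_scaleC)
qed

interpretation scaleC: bounded_bilinear "(*\<^sub>C) :: complex \<Rightarrow> 'a \<Rightarrow> 'a::complex_normed_vector"
  by (rule bounded_bilinear_scaleC)

text \<open>Rewriting to sums of scaled, right-associated products.\<close>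

lemmas cop_algebra = cop_compose_assoc cop_compose_add_left cop_compose_add_right
  cop_compose.diff_left cop_compose.diff_right cop_compose.minus_left cop_compose.minus_right
  cop_compose_scaleC_left cop_compose_scaleC_right
  scaleC_add_right scaleC_diff_right scaleC_minus_right scaleC_scaleC scaleC_one

declare scaleC_one [simp]

lemma cop_inverse_unique:
  assumes "S \<cdot> T = cop_id" "T \<cdot> S' = cop_id"
  shows "S = S'"
  by (metis assms cop_compose_assoc cop_id_left cop_id_right)

lemma cop_inv_eqI:
  assumes "S \<cdot> T = cop_id" "T \<cdot> S = cop_id"
  shows "cop_inv T = S"
  unfolding cop_inv_def
  by (rule the_equality) (use assms cop_inverse_unique in blast)+

lemma cop_invertibleI:
  assumes "S \<cdot> T = cop_id" "T \<cdot> S = cop_id"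
  shows "cop_invertible T"
  using assms unfolding cop_invertible_def by blast

lemma
  assumes "cop_invertible T"
  shows cop_inv_left [simp]: "cop_inv T \<cdot> T = cop_id"
    and cop_inv_right [simp]: "T \<cdot> cop_inv T = cop_id"
  using assms cop_inv_eqI unfolding cop_invertible_def by metis+

lemma
  assumes "cop_invertible T"
  shows cop_inv_left_cancel [simp]: "cop_inv T \<cdot> (T \<cdot> A) = A"
    and cop_inv_right_cancel [simp]: "T \<cdot> (cop_inv T \<cdot> B) = B"
  using assms by (simp_all flip: cop_compose_assoc)

lemma cop_invertible_id [simp]: "cop_invertible cop_id"
  by (rule cop_invertibleI) simp_all

lemma cop_inv_id [simp]: "cop_inv cop_id = cop_id"
  by (rule cop_inv_eqI) simp_all

lemma
  assumes "cop_invertible S" "cop_invertible T"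
  shows cop_invertible_compose: "cop_invertible (S \<cdot> T)"
    and cop_inv_compose: "cop_inv (S \<cdot> T) = cop_inv T \<cdot> cop_inv S"
  using assms
  by (auto intro!: cop_invertibleI[of "cop_inv T \<cdot> cop_inv S"] cop_inv_eqI simp: cop_compose_assoc)

lemma
  assumes "cop_invertible T" "c \<noteq> 0"
  shows cop_invertible_scaleC: "cop_invertible (c *\<^sub>C T)"
    and cop_inv_scaleC: "cop_inv (c *\<^sub>C T) = (1 / c) *\<^sub>C cop_inv T"
  using assms
  by (auto intro!: cop_invertibleI[of "(1 / c) *\<^sub>C cop_inv T"] cop_inv_eqI simp: cop_algebra)

text \<open>The Woodbury identity. It is symmetric in the roles of \<open>(P, B, C)\<close> and \<open>(D, C, B)\<close>.\<close>

lemma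
  fixes P :: "('x::complex_normed_vector, 'x) cop" and D :: "('u::complex_normed_vector, 'u) cop"
  assumes "cop_invertible P" "cop_invertible D" "cop_invertible (P + B \<cdot> cop_inv D \<cdot> C)"
  shows cop_invertible_woodbury: "cop_invertible (D + C \<cdot> cop_inv P \<cdot> B)"
    and cop_inv_woodbury: "cop_inv (D + C \<cdot> cop_inv P \<cdot> B) =
      cop_inv D - cop_inv D \<cdot> C \<cdot> cop_inv (P + B \<cdot> cop_inv D \<cdot> C) \<cdot> B \<cdot> cop_inv D"
proof -
  define W where "W = cop_inv (P + B \<cdot> cop_inv D \<cdot> C)"
  have W: "(P + B \<cdot> cop_inv D \<cdot> C) \<cdot> W = cop_id" "W \<cdot> (P + B \<cdot> cop_inv D \<cdot> C) = cop_id"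
    using assms unfolding W_def by simp_all
  have PW: "B \<cdot> cop_inv D \<cdot> C \<cdot> W = cop_id - P \<cdot> W" "W \<cdot> B \<cdot> cop_inv D \<cdot> C = cop_id - W \<cdot> P"
    using W by (simp_all add: cop_algebra eq_diff_eq add.commute)
  define S where "S = cop_inv D - cop_inv D \<cdot> C \<cdot> W \<cdot> B \<cdot> cop_inv D"
  have "(D + C \<cdot> cop_inv P \<cdot> B) \<cdot> S = cop_id + C \<cdot> cop_inv P \<cdot> B \<cdot> cop_inv D - C \<cdot> W \<cdot> B \<cdot> cop_inv D
      - C \<cdot> cop_inv P \<cdot> (B \<cdot> cop_inv D \<cdot> C \<cdot> W) \<cdot> B \<cdot> cop_inv D"
    using assms unfolding S_def by (simp add: cop_algebra)
  also have "\<dots> = cop_id"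
    unfolding PW using assms by (simp add: cop_algebra)
  finally have 1: "(D + C \<cdot> cop_inv P \<cdot> B) \<cdot> S = cop_id" .
  have "S \<cdot> (D + C \<cdot> cop_inv P \<cdot> B) = cop_id + cop_inv D \<cdot> C \<cdot> cop_inv P \<cdot> B - cop_inv D \<cdot> C \<cdot> W \<cdot> B
      - cop_inv D \<cdot> C \<cdot> (W \<cdot> B \<cdot> cop_inv D \<cdot> C) \<cdot> cop_inv P \<cdot> B"
    using assms unfolding S_def by (simp add: cop_algebra)
  also have "\<dots> = cop_id"
    unfolding PW using assms by (simp add: cop_algebra)
  finally have 2: "S \<cdot> (D + C \<cdot> cop_inv P \<cdot> B) = cop_id" .
  show "cop_invertible (D + C \<cdot> cop_inv P \<cdot> B)" by (rule cop_invertibleI[OF 2 1])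
  show "cop_inv (D + C \<cdot> cop_inv P \<cdot> B) =
      cop_inv D - cop_inv D \<cdot> C \<cdot> cop_inv (P + B \<cdot> cop_inv D \<cdot> C) \<cdot> B \<cdot> cop_inv D"
    using cop_inv_eqI[OF 2 1] unfolding S_def W_def .
qed

section \<open>Completeness and the Neumann series\<close>

instance cop :: (complex_normed_vector, complex_hilbert) banach
proof
  fix X :: "nat \<Rightarrow> ('a, 'b) cop"
  assume "Cauchy X"
  have dist: "dist (Rep_cop F) (Rep_cop G) = dist F G" for F G :: "('a, 'b) cop"
    by (simp add: dist_norm norm_cop.rep_eq minus_cop.rep_eq)
  have "Cauchy (\<lambda>n. Rep_cop (X n))"
    using \<open>Cauchy X\<close> unfolding Cauchy_def dist .
  then obtain L where L: "(\<lambda>n. Rep_cop (X n)) \<longlonglongrightarrow> L"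
    using Cauchy_convergent_iff convergent_def by blast
  have lim: "(\<lambda>n. Rep_cop (X n) x) \<longlonglongrightarrow> L x" for x
    by (intro tendsto_intros L)
  have "L (c *\<^sub>C x) = c *\<^sub>C L x" for c x
  proof (rule LIMSEQ_unique)
    show "(\<lambda>n. Rep_cop (X n) (c *\<^sub>C x)) \<longlonglongrightarrow> L (c *\<^sub>C x)" by (rule lim)
    have "Rep_cop (X n) (c *\<^sub>C x) = c *\<^sub>C Rep_cop (X n) x" for n
      using Rep_cop[of "X n"] by simp
    then show "(\<lambda>n. Rep_cop (X n) (c *\<^sub>C x)) \<longlonglongrightarrow> c *\<^sub>C L x"
      by (simp add: scaleC.tendsto lim)
  qed
  then have "Rep_cop (Abs_cop L) = L"
    by (simp add: Abs_cop_inverse)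
  then have "X \<longlonglongrightarrow> Abs_cop L"
    using L dist[of _ "Abs_cop L"] unfolding tendsto_iff by simp
  then show "convergent X" by (rule convergentI)
qed

text \<open>Powers of an operator; \<open>cop\<close> has two type parameters and so carries no monoid structure.\<close>

primrec cop_power :: "('a::complex_normed_vector, 'a) cop \<Rightarrow> nat \<Rightarrow> ('a, 'a) cop" where
  "cop_power A 0 = cop_id"
| "cop_power A (Suc n) = A \<cdot> cop_power A n"

lemma cop_power_Suc2: "cop_power A (Suc n) = cop_power A n \<cdot> A"
  by (induction n) (simp_all add: cop_compose_assoc[symmetric])

lemma cop_power_scaleC: "cop_power (c *\<^sub>C A) n = c ^ n *\<^sub>C cop_power A n"
  by (induction n) (simp_all add: cop_algebra mult.commute)

lemma norm_cop_id: "norm (cop_id :: ('a::complex_normed_vector, 'a) cop) \<le> 1"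
  by transfer (rule norm_blinfun_bound, simp_all)

lemma norm_cop_power: "norm (cop_power A n) \<le> norm A ^ n"
proof (induction n)
  case 0
  then show ?case by (simp add: norm_cop_id)
next
  case (Suc n)
  have "norm (cop_power A (Suc n)) \<le> norm A * norm (cop_power A n)"
    by (simp add: norm_cop_compose)
  also have "\<dots> \<le> norm A * norm A ^ n"
    by (rule mult_left_mono[OF Suc]) simp
  finally show ?case by simp
qed

lemma
  fixes A :: "('x::complex_hilbert, 'x) cop"
  assumes "norm A < 1"
  shows cop_invertible_one_minus: "cop_invertible (cop_id - A)"
    and neumann_sums: "cop_power A sums cop_inv (cop_id - A)"
    and norm_neumann: "norm (cop_inv (cop_id - A)) \<le> 1 / (1 - norm A)"
proof -
  have sn: "summable (\<lambda>n. norm (cop_power A n))"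
    by (rule summable_comparison_test'[of "\<lambda>n. norm A ^ n" 0])
      (use assms norm_cop_power in \<open>auto intro: summable_geometric\<close>)
  then have s: "summable (cop_power A)" by (rule summable_norm_cancel)
  define S where "S = suminf (cop_power A)"
  have sum: "cop_power A sums S" using s unfolding S_def by (rule summable_sums)
  define S' where "S' = suminf (\<lambda>n. cop_power A (Suc n))"
  have eq: "S = cop_id + S'"
    unfolding S_def S'_def using suminf_split_head[OF s] by simp
  have "S' = A \<cdot> S"
    using bounded_linear.sums[OF cop_compose.bounded_linear_right sum, of A]
    by (simp add: S'_def sums_iff)
  then have 1: "(cop_id - A) \<cdot> S = cop_id"
    using eq by (simp add: cop_compose.diff_left)
  have "S' = S \<cdot> A"
    using bounded_linear.sums[OF cop_compose.bounded_linear_left sum, of A]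
    unfolding S'_def cop_power_Suc2 by (simp add: sums_iff)
  then have 2: "S \<cdot> (cop_id - A) = cop_id"
    using eq by (simp add: cop_compose.diff_right)
  show "cop_invertible (cop_id - A)" by (rule cop_invertibleI[OF 2 1])
  have inv: "cop_inv (cop_id - A) = S" by (rule cop_inv_eqI[OF 2 1])
  show "cop_power A sums cop_inv (cop_id - A)" using sum inv by simp
  have "norm S \<le> (\<Sum>n. norm (cop_power A n))"
    unfolding S_def by (rule summable_norm[OF sn])
  also have "\<dots> \<le> (\<Sum>n. norm A ^ n)"
    by (intro suminf_le norm_cop_power sn summable_geometric) (use assms in auto)
  also have "\<dots> = 1 / (1 - norm A)"
    using suminf_geometric[of "norm A"] assms by simp
  finally show "norm (cop_inv (cop_id - A)) \<le> 1 / (1 - norm A)" unfolding inv .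
qed

text \<open>Invertibility is an open condition, and inversion is continuous.\<close>

lemma
  fixes T :: "('x::complex_hilbert, 'x) cop"
  assumes T: "cop_invertible T"
  shows eventually_cop_invertible: "\<forall>\<^sub>F S in nhds T. cop_invertible S"
    and tendsto_cop_inv: "(cop_inv \<longlongrightarrow> cop_inv T) (nhds T)"
proof -
  have lim: "((\<lambda>S. cop_inv T \<cdot> (T - S)) \<longlongrightarrow> cop_inv T \<cdot> (T - T)) (nhds T)"
    by (intro cop_compose.tendsto tendsto_diff tendsto_const tendsto_ident_at filterlim_ident)
  have ev: "\<forall>\<^sub>F S in nhds T. norm (cop_inv T \<cdot> (T - S)) < 1 / 2"
    using order_tendstoD(2)[OF tendsto_norm[OF lim], of "1/2"]
    by (simp add: cop_compose.zero_right)
  have *: "cop_invertible S \<and> norm (cop_inv S) \<le> 2 * norm (cop_inv T)"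
    if "norm (cop_inv T \<cdot> (T - S)) < 1 / 2" for S
  proof -
    let ?A = "cop_inv T \<cdot> (T - S)"
    have S: "S = T \<cdot> (cop_id - ?A)" using T by (simp add: cop_algebra)
    have i: "cop_invertible (cop_id - ?A)" by (rule cop_invertible_one_minus) (use that in simp)
    have "1 / (1 - norm ?A) \<le> 2" using that by (simp add: field_simps)
    then have n: "norm (cop_inv (cop_id - ?A)) \<le> 2"
      using norm_neumann[of ?A] that by linarith
    have "cop_inv S = cop_inv (cop_id - ?A) \<cdot> cop_inv T"
      by (subst S) (rule cop_inv_compose[OF T i])
    then have "norm (cop_inv S) \<le> norm (cop_inv (cop_id - ?A)) * norm (cop_inv T)"
      by (simp add: norm_cop_compose)
    also have "\<dots> \<le> 2 * norm (cop_inv T)" by (rule mult_right_mono[OF n]) simp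
    finally show ?thesis using cop_invertible_compose[OF T i] S by simp
  qed
  show "\<forall>\<^sub>F S in nhds T. cop_invertible S"
    using ev by eventually_elim (use * in blast)
  have "((\<lambda>S. cop_inv S - cop_inv T) \<longlongrightarrow> 0) (nhds T)"
  proof (rule Lim_null_comparison)
    show "\<forall>\<^sub>F S in nhds T. norm (cop_inv S - cop_inv T)
        \<le> 2 * norm (cop_inv T) * norm (cop_inv T \<cdot> (T - S))"
      using ev
    proof eventually_elim
      case (elim S)
      have "cop_inv S - cop_inv T = cop_inv T \<cdot> (T - S) \<cdot> cop_inv S"
        using *[OF elim] T by (simp add: cop_algebra)
      then have "norm (cop_inv S - cop_inv T) \<le> norm (cop_inv T \<cdot> (T - S)) * norm (cop_inv S)"
        by (simp add: norm_cop_compose)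
      also have "\<dots> \<le> norm (cop_inv T \<cdot> (T - S)) * (2 * norm (cop_inv T))"
        by (rule mult_left_mono) (use *[OF elim] in simp_all)
      finally show ?case by (simp add: mult.commute)
    qed
    show "((\<lambda>S. 2 * norm (cop_inv T) * norm (cop_inv T \<cdot> (T - S))) \<longlongrightarrow> 0) (nhds T)"
      using tendsto_mult_left[OF tendsto_norm[OF lim]] by (simp add: cop_compose.zero_right)
  qed
  then show "(cop_inv \<longlongrightarrow> cop_inv T) (nhds T)" by (rule LIM_zero_cancel)
qed

section \<open>Matrix coefficients of an operator\<close>

lemma cinner_add_right: "cinner x (y + z) = cinner x y + cinner x z"
  by (metis cinner_add_left cinner_commute complex_cnj_add)

lemma cinner_scaleC_right: "cinner x (c *\<^sub>C y) = cnj c * cinner x y"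
  by (metis cinner_scaleC_left cinner_commute complex_cnj_mult)

lemma cinner_diff_left: "cinner (x - y) z = cinner x z - cinner y z"
  using cinner_add_left[of "x - y" y z] by simp

lemma cinner_diff_right: "cinner x (y - z) = cinner x y - cinner x z"
  using cinner_add_right[of x "y - z" z] by simp

lemma norm_cinner_le: "norm (cinner x y) \<le> norm x * norm y"
proof (cases "y = 0")
  case True
  then have "cinner x y = 0" using cinner_diff_right[of x y y] by simp
  then show ?thesis using True by simp
next
  case False
  define c where "c = cinner x y / of_real ((norm y)\<^sup>2)"
  have c: "c * of_real ((norm y)\<^sup>2) = cinner x y" using False by (simp add: c_def)
  have "complex_of_real ((norm (x - c *\<^sub>C y))\<^sup>2) = cinner (x - c *\<^sub>C y) (x - c *\<^sub>C y)"
    by (simp add: cinner_self)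
  also have "\<dots> = cinner x x - cnj c * cinner x y - c * cinner y x + c * cnj c * cinner y y"
    by (simp add: cinner_diff_left cinner_diff_right cinner_scaleC_left cinner_scaleC_right
        algebra_simps)
  also have "\<dots> = cinner x x - c * cinner y x"
    using c by (simp add: cinner_self algebra_simps)
  also have "c * cinner y x = of_real ((norm (cinner x y))\<^sup>2 / (norm y)\<^sup>2)"
    unfolding c_def cinner_commute[of y x] by (simp add: complex_norm_square del: of_real_power)
  also have "cinner x x - \<dots> = of_real ((norm x)\<^sup>2 - (norm (cinner x y))\<^sup>2 / (norm y)\<^sup>2)"
    by (simp add: cinner_self)
  finally have "(norm (x - c *\<^sub>C y))\<^sup>2 = (norm x)\<^sup>2 - (norm (cinner x y))\<^sup>2 / (norm y)\<^sup>2"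
    unfolding of_real_eq_iff .
  then have "(norm (cinner x y))\<^sup>2 / (norm y)\<^sup>2 \<le> (norm x)\<^sup>2"
    using zero_le_power2[of "norm (x - c *\<^sub>C y)"] by linarith
  then have "(norm (cinner x y))\<^sup>2 \<le> (norm x * norm y)\<^sup>2"
    using False by (simp add: field_simps power_mult_distrib)
  then show ?thesis by (rule power2_le_imp_le) simp
qed

text \<open>The matrix coefficient \<open>\<langle>A x, y\<rangle>\<close>, a bounded complex-linear functional of \<open>A\<close>. These functionals
  separate the operators and carry over results on scalar holomorphic functions.\<close>

definition matrix_coeff ::
  "'a::complex_normed_vector \<Rightarrow> 'b::complex_hilbert \<Rightarrow> ('a, 'b) cop \<Rightarrow> complex"
  where "matrix_coeff x y A = cinner (cop_apply A x) y"

lemma matrix_coeff_scaleC: "matrix_coeff x y (c *\<^sub>C A) = c * matrix_coeff x y A"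
  by (simp add: matrix_coeff_def cop_apply_scaleC cinner_scaleC_left)

lemma bounded_linear_matrix_coeff: "bounded_linear (matrix_coeff x y)"
proof (rule bounded_linear_intro)
  fix A B :: "('a, 'b) cop" and r :: real
  show "matrix_coeff x y (A + B) = matrix_coeff x y A + matrix_coeff x y B"
    by (simp add: matrix_coeff_def cop_apply_add cinner_add_left)
  show "matrix_coeff x y (r *\<^sub>R A) = r *\<^sub>R matrix_coeff x y A"
    by (simp add: scaleR_scaleC matrix_coeff_scaleC scaleC_complex_def)
  show "norm (matrix_coeff x y A) \<le> norm A * (norm x * norm y)"
    using order_trans[OF norm_cinner_le mult_right_mono[OF norm_cop_apply norm_ge_zero]]
    unfolding matrix_coeff_def mult.assoc .
qed

lemma cop_eq_matrix_coeffI: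
  assumes "\<And>x y. matrix_coeff x y A = matrix_coeff x y B"
  shows "A = B"
proof (rule cop_eqI)
  fix x
  have "cinner (cop_apply A x - cop_apply B x) (cop_apply A x - cop_apply B x) = 0"
    using assms by (simp add: matrix_coeff_def cinner_diff_left)
  then show "cop_apply A x = cop_apply B x" by (simp add: cinner_self)
qed

section \<open>Operator-valued analytic functions\<close>

text \<open>Complex differentiability in norm at a single point.\<close>

definition vec_differentiable_at :: "(complex \<Rightarrow> 'a::complex_normed_vector) \<Rightarrow> complex \<Rightarrow> bool"
  where "vec_differentiable_at F z \<longleftrightarrow>
    (\<exists>D. ((\<lambda>w. (1 / (w - z)) *\<^sub>C (F w - F z)) \<longlongrightarrow> D) (at z))"

lemma vec_analytic_on_iff: "vec_analytic_on F S \<longleftrightarrow> (\<forall>z\<in>S. vec_differentiable_at F z)"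
  by (simp add: vec_analytic_on_def vec_differentiable_at_def)

lemma vec_differentiable_at_cong:
  assumes "\<forall>\<^sub>F w in nhds z. F w = G w"
  shows "vec_differentiable_at F z \<longleftrightarrow> vec_differentiable_at G z"
proof -
  have z: "F z = G z" using assms by (rule eventually_nhds_x_imp_x)
  have "((\<lambda>w. (1 / (w - z)) *\<^sub>C (F w - F z)) \<longlongrightarrow> D) (at z) \<longleftrightarrow>
        ((\<lambda>w. (1 / (w - z)) *\<^sub>C (G w - G z)) \<longlongrightarrow> D) (at z)" for D
    by (rule tendsto_cong)
      (use eventually_nhds_conv_at[of "\<lambda>w. F w = G w" z] assms z in \<open>auto elim: eventually_mono\<close>)
  then show ?thesis by (simp add: vec_differentiable_at_def)
qed

text \<open>Caratheodory's form of differentiability, in the following two lemmas, replaces limits of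
  difference quotients by algebra with continuous functions.\<close>

lemma vec_differentiable_atI_factor:
  assumes "isCont g z" "\<forall>\<^sub>F w in at z. F w - F z = (w - z) *\<^sub>C g w"
  shows "vec_differentiable_at F z"
  unfolding vec_differentiable_at_def
proof (rule exI[of _ "g z"], rule Lim_transform_eventually)
  show "(g \<longlongrightarrow> g z) (at z)" using assms(1) by (simp add: isCont_def)
  show "\<forall>\<^sub>F w in at z. g w = (1 / (w - z)) *\<^sub>C (F w - F z)"
    using assms(2) eventually_neq_at_within[of z z]
    by eventually_elim (simp add: scaleC_scaleC)
qed

lemma vec_differentiable_at_factor:
  assumes "vec_differentiable_at F z"
  obtains g where "isCont g z" "\<And>w. F w - F z = (w - z) *\<^sub>C g w"
proof -
  obtain D where D: "((\<lambda>w. (1 / (w - z)) *\<^sub>C (F w - F z)) \<longlongrightarrow> D) (at z)"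
    using assms unfolding vec_differentiable_at_def by blast
  define g where "g w = (if w = z then D else (1 / (w - z)) *\<^sub>C (F w - F z))" for w
  have "(g \<longlongrightarrow> D) (at z)"
  proof (rule Lim_transform_eventually[OF D])
    show "\<forall>\<^sub>F w in at z. (1 / (w - z)) *\<^sub>C (F w - F z) = g w"
      using eventually_neq_at_within[of z z UNIV] by eventually_elim (simp add: g_def)
  qed
  then have "isCont g z" by (simp add: isCont_def g_def)
  moreover have "F w - F z = (w - z) *\<^sub>C g w" for w
    by (simp add: g_def scaleC_scaleC scaleC.zero_left)
  ultimately show thesis by (rule that)
qed

lemma vec_differentiable_at_isCont:
  assumes "vec_differentiable_at F z"
  shows "isCont F z"
proof -
  obtain g where g: "isCont g z" "\<And>w. F w - F z = (w - z) *\<^sub>C g w"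
    using vec_differentiable_at_factor[OF assms] by blast
  have "F = (\<lambda>w. F z + (w - z) *\<^sub>C g w)" by (simp flip: g(2))
  moreover have "isCont (\<lambda>w. F z + (w - z) *\<^sub>C g w) z"
    by (intro continuous_intros scaleC.continuous g)
  ultimately show ?thesis by simp
qed

lemma vec_differentiable_at_const: "vec_differentiable_at (\<lambda>_. A) z"
  by (rule vec_differentiable_atI_factor[where g = "\<lambda>_. 0"]) simp_all

lemma vec_differentiable_at_ident: "vec_differentiable_at (\<lambda>w. w *\<^sub>C A) z"
  by (rule vec_differentiable_atI_factor[where g = "\<lambda>_. A"]) (simp_all add: scaleC.diff_left)

lemma vec_differentiable_at_add:
  assumes "vec_differentiable_at F z" "vec_differentiable_at G z"
  shows "vec_differentiable_at (\<lambda>w. F w + G w) z"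
proof -
  obtain f where f: "isCont f z" "\<And>w. F w - F z = (w - z) *\<^sub>C f w"
    using vec_differentiable_at_factor[OF assms(1)] by blast
  obtain g where g: "isCont g z" "\<And>w. G w - G z = (w - z) *\<^sub>C g w"
    using vec_differentiable_at_factor[OF assms(2)] by blast
  show ?thesis
  proof (rule vec_differentiable_atI_factor[where g = "\<lambda>w. f w + g w"])
    show "isCont (\<lambda>w. f w + g w) z" by (intro continuous_intros f g)
    have "F w + G w - (F z + G z) = (F w - F z) + (G w - G z)" for w by simp
    then have "F w + G w - (F z + G z) = (w - z) *\<^sub>C (f w + g w)" for w
      unfolding f(2) g(2) by (simp add: scaleC_add_right)
    then show "\<forall>\<^sub>F w in at z. F w + G w - (F z + G z) = (w - z) *\<^sub>C (f w + g w)" by simp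
  qed
qed

lemma vec_differentiable_at_compose:
  assumes "vec_differentiable_at F z" "vec_differentiable_at G z"
  shows "vec_differentiable_at (\<lambda>w. F w \<cdot> G w) z"
proof -
  obtain f where f: "isCont f z" "\<And>w. F w - F z = (w - z) *\<^sub>C f w"
    using vec_differentiable_at_factor[OF assms(1)] by blast
  obtain g where g: "isCont g z" "\<And>w. G w - G z = (w - z) *\<^sub>C g w"
    using vec_differentiable_at_factor[OF assms(2)] by blast
  show ?thesis
  proof (rule vec_differentiable_atI_factor[where g = "\<lambda>w. F w \<cdot> g w + f w \<cdot> G z"])
    show "isCont (\<lambda>w. F w \<cdot> g w + f w \<cdot> G z) z"
      by (intro continuous_intros cop_compose.continuous f g vec_differentiable_at_isCont assms)
    have "F w \<cdot> G w - F z \<cdot> G z = F w \<cdot> (G w - G z) + (F w - F z) \<cdot> G z" for w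
      by (simp add: cop_compose.diff_left cop_compose.diff_right)
    then have "F w \<cdot> G w - F z \<cdot> G z = (w - z) *\<^sub>C (F w \<cdot> g w + f w \<cdot> G z)" for w
      unfolding f(2) g(2) by (simp add: cop_algebra)
    then show "\<forall>\<^sub>F w in at z. F w \<cdot> G w - F z \<cdot> G z = (w - z) *\<^sub>C (F w \<cdot> g w + f w \<cdot> G z)"
      by simp
  qed
qed

lemma vec_differentiable_at_scale:
  fixes F :: "complex \<Rightarrow> ('a::complex_normed_vector, 'b::complex_normed_vector) cop"
  assumes "vec_differentiable_at F z"
  shows "vec_differentiable_at (\<lambda>w. w *\<^sub>C F w) z"
  using vec_differentiable_at_compose[OF vec_differentiable_at_ident[of cop_id] assms]
  by (simp add: cop_algebra)

lemma vec_differentiable_at_minus: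
  fixes F :: "complex \<Rightarrow> ('a::complex_normed_vector, 'b::complex_normed_vector) cop"
  assumes "vec_differentiable_at F z"
  shows "vec_differentiable_at (\<lambda>w. - F w) z"
  using vec_differentiable_at_compose[OF vec_differentiable_at_const[of "- cop_id"] assms]
  by (simp add: cop_algebra)

lemma vec_differentiable_at_diff:
  fixes F :: "complex \<Rightarrow> ('a::complex_normed_vector, 'b::complex_normed_vector) cop"
  assumes "vec_differentiable_at F z" "vec_differentiable_at G z"
  shows "vec_differentiable_at (\<lambda>w. F w - G w) z"
  using vec_differentiable_at_add[OF assms(1) vec_differentiable_at_minus[OF assms(2)]] by simp

lemma vec_differentiable_at_cop_inv:
  fixes F :: "complex \<Rightarrow> ('a::complex_hilbert, 'a) cop"
  assumes F: "vec_differentiable_at F z" and inv: "cop_invertible (F z)"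
  shows "vec_differentiable_at (\<lambda>w. cop_inv (F w)) z"
proof -
  obtain f where f: "isCont f z" "\<And>w. F w - F z = (w - z) *\<^sub>C f w"
    using vec_differentiable_at_factor[OF F] by blast
  have lim: "filterlim F (nhds (F z)) (at z)"
    using vec_differentiable_at_isCont[OF F] by (simp add: isCont_def)
  have ev: "\<forall>\<^sub>F w in at z. cop_invertible (F w)"
    using eventually_cop_invertible[OF inv] lim by (simp add: filterlim_iff)
  have "((\<lambda>w. cop_inv (F w)) \<longlongrightarrow> cop_inv (F z)) (at z)"
    by (rule filterlim_compose[OF tendsto_cop_inv[OF inv] lim])
  then have cont: "isCont (\<lambda>w. cop_inv (F w)) z" by (simp add: isCont_def)
  show ?thesis
  proof (rule vec_differentiable_atI_factor[where g = "\<lambda>w. - (cop_inv (F w) \<cdot> f w \<cdot> cop_inv (F z))"])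
    show "isCont (\<lambda>w. - (cop_inv (F w) \<cdot> f w \<cdot> cop_inv (F z))) z"
      by (intro continuous_intros cop_compose.continuous cont f)
    show "\<forall>\<^sub>F w in at z. cop_inv (F w) - cop_inv (F z) =
        (w - z) *\<^sub>C (- (cop_inv (F w) \<cdot> f w \<cdot> cop_inv (F z)))"
      using ev
    proof eventually_elim
      case (elim w)
      have "cop_inv (F w) - cop_inv (F z) = - (cop_inv (F w) \<cdot> (F w - F z) \<cdot> cop_inv (F z))"
        using elim inv by (simp add: cop_algebra)
      then show ?case unfolding f(2) by (simp add: cop_algebra)
    qed
  qed
qed

lemma vec_differentiable_at_inverse_arg:
  assumes F: "vec_differentiable_at F (1 / z)" and z: "z \<noteq> 0"
  shows "vec_differentiable_at (\<lambda>w. F (1 / w)) z"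
proof -
  obtain f where f: "isCont f (1 / z)" "\<And>w. F w - F (1 / z) = (w - 1 / z) *\<^sub>C f w"
    using vec_differentiable_at_factor[OF F] by blast
  show ?thesis
  proof (rule vec_differentiable_atI_factor[where g = "\<lambda>w. (- 1 / (w * z)) *\<^sub>C f (1 / w)"])
    have "isCont (\<lambda>w. f (1 / w)) z"
      by (rule isCont_o2[of z "\<lambda>w. 1 / w" f]) (use f z in \<open>auto intro!: continuous_intros\<close>)
    then show "isCont (\<lambda>w. (- 1 / (w * z)) *\<^sub>C f (1 / w)) z"
      using z by (intro scaleC.continuous continuous_intros) auto
    have "\<forall>\<^sub>F w in at z. w \<noteq> 0" using z eventually_neq_at_within by blast
    then show "\<forall>\<^sub>F w in at z. F (1 / w) - F (1 / z) = (w - z) *\<^sub>C ((- 1 / (w * z)) *\<^sub>C f (1 / w))"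
    proof eventually_elim
      case (elim w)
      have "1 / w - 1 / z = (w - z) * (- 1 / (w * z))" using elim z by (simp add: field_simps)
      then show ?case unfolding f(2) by (simp only: scaleC_scaleC)
    qed
  qed
qed

lemma vec_differentiable_at_matrix_coeff:
  assumes "vec_differentiable_at F z"
  shows "(\<lambda>w. matrix_coeff x y (F w)) field_differentiable at z"
proof -
  obtain D where D: "((\<lambda>w. (1 / (w - z)) *\<^sub>C (F w - F z)) \<longlongrightarrow> D) (at z)"
    using assms unfolding vec_differentiable_at_def by blast
  interpret bounded_linear "matrix_coeff x y" by (rule bounded_linear_matrix_coeff)
  have "((\<lambda>w. (matrix_coeff x y (F w) - matrix_coeff x y (F z)) / (w - z))
      \<longlongrightarrow> matrix_coeff x y D) (at z)"
    using tendsto[OF D] by (simp add: matrix_coeff_scaleC diff)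
  then show ?thesis
    unfolding field_differentiable_def has_field_derivative_iff by blast
qed

lemma open_cop_invertible:
  fixes F :: "complex \<Rightarrow> ('a::complex_hilbert, 'a) cop"
  assumes "\<And>z. isCont F z"
  shows "open {z. cop_invertible (F z)}"
proof -
  have "open {A :: ('a, 'a) cop. cop_invertible A}"
    unfolding open_subopen[of "Collect cop_invertible"]
  proof
    fix A :: "('a, 'a) cop"
    assume "A \<in> Collect cop_invertible"
    then show "\<exists>T. open T \<and> A \<in> T \<and> T \<subseteq> Collect cop_invertible"
      using eventually_cop_invertible[of A] unfolding eventually_nhds by auto
  qed
  then show ?thesis
    using continuous_open_preimage[of UNIV F "Collect cop_invertible"] assms
    by (simp add: continuous_at_imp_continuous_on vimage_def)
qed

lemma vec_differentiable_at_power_series: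
  fixes c :: "nat \<Rightarrow> 'a::{complex_normed_vector, banach}"
  assumes c: "\<And>n. norm (c n) \<le> M / r ^ n" and r: "r > 0"
    and F: "\<And>z. norm z < r \<Longrightarrow> (\<lambda>n. z ^ n *\<^sub>C c n) sums F z" and z: "norm z < r"
  shows "vec_differentiable_at F z"
proof -
  obtain \<rho> where \<rho>: "norm z < \<rho>" "\<rho> < r" using dense[OF z] by blast
  then have "\<rho> > 0" using norm_ge_zero[of z] by linarith
  \<comment> \<open>\<open>h n\<close> is the difference quotient of \<open>w ^ n c\<^sub>n\<close> between \<open>w\<close> and \<open>z\<close>, without division.\<close>
  define h where "h n w = (\<Sum>i<n. z ^ (n - Suc i) * w ^ i) *\<^sub>C c n" for n w
  define g where "g w = (\<Sum>n. h n w)" for w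
  define b where "b n = M / \<rho> * (of_nat (Suc n) * (\<rho> / r) ^ n)" for n
  have "M \<ge> 0" using order_trans[OF norm_ge_zero c[of 0]] by simp
  have bound: "norm (h n w) \<le> b n" if w: "w \<in> ball 0 \<rho>" for n w
  proof -
    have "norm (\<Sum>i<n. z ^ (n - Suc i) * w ^ i) \<le> (\<Sum>i<n. \<rho> ^ (n - 1))"
    proof (rule sum_norm_le)
      fix i assume "i \<in> {..<n}"
      then have i: "n - 1 = (n - Suc i) + i" by simp
      have "norm (z ^ (n - Suc i) * w ^ i) = norm z ^ (n - Suc i) * norm w ^ i"
        by (simp add: norm_mult norm_power)
      also have "\<dots> \<le> \<rho> ^ (n - Suc i) * \<rho> ^ i"
        by (intro mult_mono power_mono) (use w \<rho> \<open>\<rho> > 0\<close> in auto)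
      finally show "norm (z ^ (n - Suc i) * w ^ i) \<le> \<rho> ^ (n - 1)" unfolding i power_add .
    qed
    also have "\<dots> = of_nat n * \<rho> ^ n / \<rho>" using \<open>\<rho> > 0\<close> by (cases n) auto
    also have "\<dots> \<le> of_nat (Suc n) * \<rho> ^ n / \<rho>"
      using \<open>\<rho> > 0\<close> by (intro divide_right_mono mult_right_mono) auto
    finally have "norm (h n w) \<le> (of_nat (Suc n) * \<rho> ^ n / \<rho>) * (M / r ^ n)"
      unfolding h_def norm_scaleC using \<open>\<rho> > 0\<close> by (intro mult_mono c) auto
    also have "\<dots> = b n" by (simp add: b_def power_divide)
    finally show ?thesis .
  qed
  have "summable b"
    unfolding b_def
    by (intro summable_mult sums_summable[OF geometric_deriv_sums])
      (use \<rho> \<open>\<rho> > 0\<close> r in auto)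
  then have ul: "uniform_limit (ball 0 \<rho>) (\<lambda>n w. \<Sum>i<n. h i w) g sequentially"
    unfolding g_def using bound by (intro Weierstrass_m_test) auto
  have "continuous_on (ball 0 \<rho>) g"
    by (rule uniform_limit_theorem[OF _ ul])
      (auto simp: h_def intro!: always_eventually continuous_intros scaleC.continuous_on)
  then have cont: "isCont g z"
    using \<rho> by (simp add: continuous_on_eq_continuous_at)
  have eq: "F w - F z = (w - z) *\<^sub>C g w" if w: "w \<in> ball 0 \<rho>" for w
  proof (rule sums_unique2)
    have "(\<lambda>n. w ^ n *\<^sub>C c n - z ^ n *\<^sub>C c n) sums (F w - F z)"
      by (intro sums_diff F) (use w \<rho> in auto)
    also have "(\<lambda>n. w ^ n *\<^sub>C c n - z ^ n *\<^sub>C c n) = (\<lambda>n. (w - z) *\<^sub>C h n w)"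
      by (simp only: h_def scaleC_scaleC power_diff_sumr2 scaleC.diff_left[symmetric])
    finally show "(\<lambda>n. (w - z) *\<^sub>C h n w) sums (F w - F z)" .
    have "summable (\<lambda>n. h n w)"
      by (rule summable_norm_cancel, rule summable_comparison_test'[OF \<open>summable b\<close>, of 0])
        (use bound w in auto)
    then show "(\<lambda>n. (w - z) *\<^sub>C h n w) sums ((w - z) *\<^sub>C g w)"
      unfolding g_def by (intro bounded_linear.sums[OF scaleC.bounded_linear_right] summable_sums)
  qed
  show ?thesis
  proof (rule vec_differentiable_atI_factor[OF cont])
    have "\<forall>\<^sub>F w in at z. w \<in> ball 0 \<rho>"
      by (rule eventually_at_in_open') (use \<rho> in auto)
    then show "\<forall>\<^sub>F w in at z. F w - F z = (w - z) *\<^sub>C g w"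
      by eventually_elim (rule eq)
  qed
qed

section \<open>Functions analytic on the closed unit disc\<close>

text \<open>Analytic on some open set that contains the closed unit disc.\<close>

definition disc_analytic :: "(complex \<Rightarrow> 'a::complex_normed_vector) \<Rightarrow> bool"
  where "disc_analytic F \<longleftrightarrow> (\<exists>S. open S \<and> cball 0 1 \<subseteq> S \<and> vec_analytic_on F S)"

lemma disc_analyticI:
  assumes "open S" "cball 0 1 \<subseteq> S" "\<And>z. z \<in> S \<Longrightarrow> vec_differentiable_at F z"
  shows "disc_analytic F"
  using assms unfolding disc_analytic_def vec_analytic_on_iff by blast

lemma disc_analytic_combine:
  assumes "disc_analytic F" "disc_analytic G"
    and "\<And>z. vec_differentiable_at F z \<Longrightarrow> vec_differentiable_at G z \<Longrightarrow> vec_differentiable_at H z"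
  shows "disc_analytic H"
proof -
  obtain S where S: "open S" "cball 0 1 \<subseteq> S" "vec_analytic_on F S"
    using assms(1) unfolding disc_analytic_def by blast
  obtain T where T: "open T" "cball 0 1 \<subseteq> T" "vec_analytic_on G T"
    using assms(2) unfolding disc_analytic_def by blast
  show ?thesis
    by (rule disc_analyticI[of "S \<inter> T"]) (use S T assms(3) in \<open>auto simp: vec_analytic_on_iff\<close>)
qed

lemma disc_analytic_const: "disc_analytic (\<lambda>_. A)"
  by (rule disc_analyticI[of UNIV]) (simp_all add: vec_differentiable_at_const)

lemma disc_analytic_add:
  "disc_analytic F \<Longrightarrow> disc_analytic G \<Longrightarrow> disc_analytic (\<lambda>z. F z + G z)"
  by (erule (1) disc_analytic_combine) (rule vec_differentiable_at_add)

lemma disc_analytic_diff: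
  fixes F :: "complex \<Rightarrow> ('a::complex_normed_vector, 'b::complex_normed_vector) cop"
  shows "disc_analytic F \<Longrightarrow> disc_analytic G \<Longrightarrow> disc_analytic (\<lambda>z. F z - G z)"
  by (erule (1) disc_analytic_combine) (rule vec_differentiable_at_diff)

lemma disc_analytic_compose:
  "disc_analytic F \<Longrightarrow> disc_analytic G \<Longrightarrow> disc_analytic (\<lambda>z. F z \<cdot> G z)"
  by (erule (1) disc_analytic_combine) (rule vec_differentiable_at_compose)

lemma disc_analytic_scale:
  fixes F :: "complex \<Rightarrow> ('a::complex_normed_vector, 'b::complex_normed_vector) cop"
  shows "disc_analytic F \<Longrightarrow> disc_analytic (\<lambda>z. z *\<^sub>C F z)"
  by (rule disc_analytic_combine[of F F]) (auto intro: vec_differentiable_at_scale)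

lemmas disc_analytic_intros = disc_analytic_const disc_analytic_add disc_analytic_diff
  disc_analytic_compose disc_analytic_scale

lemma vector_derivative_circlepath_0:
  assumes "t \<in> {0..1}"
  shows "vector_derivative (circlepath 0 r) (at t within {0..1}) =
    2 * of_real pi * \<i> * circlepath 0 r t"
proof -
  have "circlepath 0 r t = r * exp (2 * of_real pi * \<i> * of_real t)" by (simp add: circlepath)
  then show ?thesis using assms by (simp add: vector_derivative_circlepath01)
qed

text \<open>Cauchy's formula for the Taylor coefficients at \<open>0\<close>, as an integral over the parameter of the
  circle.\<close>

lemma Cauchy_circle_integral:
  assumes f: "f holomorphic_on S" "open S" "cball 0 r \<subseteq> S" and r: "r > 0"
  shows "((\<lambda>t. f (circlepath 0 r t) / circlepath 0 r t ^ k)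
    has_integral (deriv ^^ k) f 0 / fact k) {0..1}"
proof -
  let ?\<gamma> = "circlepath 0 r"
  have "((\<lambda>u. f u / (u - 0) ^ Suc k) has_contour_integral
      (2 * pi * \<i>) / (fact k) * (deriv ^^ k) f 0) ?\<gamma>"
  proof (rule Cauchy_has_contour_integral_higher_derivative_circlepath)
    show "continuous_on (cball 0 r) f"
      using f by (meson holomorphic_on_imp_continuous_on holomorphic_on_subset)
    show "f holomorphic_on ball 0 r" using f by (meson ball_subset_cball holomorphic_on_subset)
    show "0 \<in> ball 0 r" using r by simp
  qed
  then have "((\<lambda>t. f (?\<gamma> t) / ?\<gamma> t ^ Suc k * vector_derivative ?\<gamma> (at t within {0..1}))
      has_integral (2 * pi * \<i>) / (fact k) * (deriv ^^ k) f 0) {0..1}"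
    unfolding has_contour_integral_def by simp
  then have "((\<lambda>t. (2 * pi * \<i>) * (f (?\<gamma> t) / ?\<gamma> t ^ k))
      has_integral (2 * pi * \<i>) * ((deriv ^^ k) f 0 / fact k)) {0..1}"
  proof (rule has_integral_eq_rhs[OF has_integral_eq[rotated]])
    fix t :: real assume "t \<in> {0..1}"
    then have "vector_derivative ?\<gamma> (at t within {0..1}) = 2 * pi * \<i> * ?\<gamma> t"
      using vector_derivative_circlepath_0 by simp
    moreover have "?\<gamma> t \<noteq> 0" using r by (simp add: circlepath)
    ultimately show "f (?\<gamma> t) / ?\<gamma> t ^ Suc k * vector_derivative ?\<gamma> (at t within {0..1}) =
        2 * pi * \<i> * (f (?\<gamma> t) / ?\<gamma> t ^ k)"
      by simp
  qed simp
  from has_integral_mult_right[OF this, of "1 / (2 * pi * \<i>)"] show ?thesis by simp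
qed

lemma disc_analytic_ball:
  assumes "disc_analytic F"
  obtains r S where "r > 1" "open S" "cball 0 r \<subseteq> S" "vec_analytic_on F S"
proof -
  obtain S where S: "open S" "cball 0 1 \<subseteq> S" "vec_analytic_on F S"
    using assms unfolding disc_analytic_def by blast
  obtain e where e: "e > 0" "(\<Union>x\<in>cball 0 1. cball x e) \<subseteq> S"
    using compact_subset_open_imp_cball_epsilon_subset[OF compact_cball S(1,2)] by blast
  have "cball 0 (1 + e) \<subseteq> S"
  proof
    fix z :: complex assume z: "z \<in> cball 0 (1 + e)"
    show "z \<in> S"
    proof (cases "norm z \<le> 1")
      case True
      then show ?thesis using S(2) by auto
    next
      case False
      then have n: "norm z > 1" by simp
      have "z - sgn z = (1 - 1 / norm z) *\<^sub>R z"
        by (simp add: sgn_div_norm scaleR_diff_left inverse_eq_divide)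
      then have "norm (z - sgn z) = \<bar>1 - 1 / norm z\<bar> * norm z" by simp
      also have "\<bar>1 - 1 / norm z\<bar> = 1 - 1 / norm z" using n by (intro abs_of_nonneg) (simp add: divide_le_eq_1)
      also have "\<dots> * norm z = norm z - 1" using n by (auto simp: left_diff_distrib)
      finally have "dist (sgn z) z = norm z - 1" by (simp add: dist_norm norm_minus_commute)
      then have "z \<in> cball (sgn z) e" "sgn z \<in> cball 0 1" using z n by (auto simp: norm_sgn)
      then show ?thesis using e(2) by blast
    qed
  qed
  then show thesis using that[of "1 + e" S] S e by simp
qed

lemma matrix_coeff_holomorphic:
  "vec_analytic_on F S \<Longrightarrow> (\<lambda>z. matrix_coeff x y (F z)) holomorphic_on S"
  unfolding vec_analytic_on_iff holomorphic_on_def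
  using vec_differentiable_at_matrix_coeff field_differentiable_at_within by blast

text \<open>The Taylor series converges in norm: the coefficients are norm integrals over a circle of radius
  \<open>r > 1\<close>, and the sum is identified by its matrix coefficients.\<close>

lemma disc_analytic_power_series:
  fixes F :: "complex \<Rightarrow> ('a::complex_normed_vector, 'b::complex_hilbert) cop"
  assumes "disc_analytic F"
  obtains a r M where "r > 1" "\<And>n. norm (a n) \<le> M / r ^ n"
    "\<And>z. norm z < r \<Longrightarrow> (\<lambda>n. z ^ n *\<^sub>C a n) sums F z"
proof -
  obtain r S where r: "r > 1" and S: "open S" "cball 0 r \<subseteq> S" and F: "vec_analytic_on F S"
    using disc_analytic_ball[OF assms] by blast
  let ?\<gamma> = "circlepath 0 r"
  have \<gamma>: "norm (?\<gamma> t) = r" "?\<gamma> t \<noteq> 0" for t using r by (auto simp: circlepath norm_mult)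
  define h where "h n t = (1 / ?\<gamma> t ^ n) *\<^sub>C F (?\<gamma> t)" for n t
  define a where "a n = integral {0..1} (h n)" for n
  have contF: "continuous_on S F"
    using F vec_differentiable_at_isCont continuous_at_imp_continuous_on
    unfolding vec_analytic_on_iff by blast
  have cont\<gamma>: "continuous_on {0..1} ?\<gamma>"
    unfolding circlepath by (intro continuous_intros)
  have "continuous_on {0..1} (\<lambda>t. F (?\<gamma> t))"
    by (rule continuous_on_compose2[OF contF cont\<gamma>]) (use S \<gamma> in auto)
  then have "continuous_on {0..1} (h n)" for n
    unfolding h_def using cont\<gamma> \<gamma>(2) by (intro scaleC.continuous_on continuous_intros) auto
  then have int: "h n integrable_on {0..1}" for n
    by (rule integrable_continuous_real)
  have "bounded (F ` sphere 0 r)"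
    by (intro compact_imp_bounded compact_continuous_image continuous_on_subset[OF contF])
      (use S sphere_cball[of 0 r] in auto)
  then obtain M where M: "\<And>z. norm z = r \<Longrightarrow> norm (F z) \<le> M"
    unfolding bounded_iff by (metis imageI mem_sphere_0)
  have bound: "norm (a n) \<le> M / r ^ n" for n
  proof -
    have "norm (a n) \<le> M / r ^ n * measure lborel (cbox 0 (1::real))"
    proof (rule has_integral_bound)
      have "0 \<le> M" using M[OF \<gamma>(1)] norm_ge_zero order_trans by blast
      then show "0 \<le> M / r ^ n" using r by simp
      show "(h n has_integral a n) (cbox 0 1)"
        unfolding a_def box_real by (rule integrable_integral[OF int])
      show "norm (h n t) \<le> M / r ^ n" for t
        using M[OF \<gamma>(1)[of t]] r \<gamma>
        by (simp add: h_def norm_scaleC norm_divide norm_power divide_right_mono)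
    qed
    then show ?thesis by simp
  qed
  have "(\<lambda>n. z ^ n *\<^sub>C a n) sums F z" if z: "norm z < r" for z
  proof -
    have sM: "summable (\<lambda>n. M * (norm z / r) ^ n)"
      by (intro summable_mult summable_geometric) (use z r in simp)
    have "norm (z ^ n *\<^sub>C a n) \<le> M * (norm z / r) ^ n" for n
      using mult_left_mono[OF bound[of n], of "norm z ^ n"]
      by (simp add: norm_scaleC norm_power power_divide mult.commute)
    then have "summable (\<lambda>n. z ^ n *\<^sub>C a n)"
      by (rule summable_comparison_test'[OF sM, of 0])
    then obtain G where G: "(\<lambda>n. z ^ n *\<^sub>C a n) sums G" using summable_def by blast
    have "matrix_coeff x y G = matrix_coeff x y (F z)" for x y
    proof (rule sums_unique2)
      interpret bounded_linear "matrix_coeff x y" by (rule bounded_linear_matrix_coeff)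
      let ?f = "\<lambda>z. matrix_coeff x y (F z)"
      have hol: "?f holomorphic_on S" using F by (rule matrix_coeff_holomorphic)
      have coeff: "matrix_coeff x y (a n) = (deriv ^^ n) ?f 0 / fact n" for n
      proof (rule has_integral_unique)
        show "((\<lambda>t. ?f (?\<gamma> t) / ?\<gamma> t ^ n) has_integral (deriv ^^ n) ?f 0 / fact n) {0..1}"
          by (rule Cauchy_circle_integral[OF hol S]) (use r in simp)
        show "((\<lambda>t. ?f (?\<gamma> t) / ?\<gamma> t ^ n) has_integral matrix_coeff x y (a n)) {0..1}"
          using has_integral_linear[OF integrable_integral[OF int[of n]] bounded_linear_axioms]
          by (simp add: a_def h_def[abs_def] o_def matrix_coeff_scaleC)
      qed
      show "(\<lambda>n. matrix_coeff x y (z ^ n *\<^sub>C a n)) sums matrix_coeff x y G"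
        by (rule sums[OF G])
      have "?f holomorphic_on ball 0 r"
        using hol S by (meson ball_subset_cball holomorphic_on_subset)
      then have "(\<lambda>n. (deriv ^^ n) ?f 0 / fact n * (z - 0) ^ n) sums ?f z"
        by (rule holomorphic_power_series) (use z in simp)
      then show "(\<lambda>n. matrix_coeff x y (z ^ n *\<^sub>C a n)) sums ?f z"
        by (simp add: matrix_coeff_scaleC coeff mult.commute)
    qed
    then have "G = F z" by (rule cop_eq_matrix_coeffI)
    then show ?thesis using G by simp
  qed
  then show thesis using that r bound by blast
qed

text \<open>Both values are integrals over the unit circle, \<open>f a\<close> that of \<open>f(z) z / (z - a)\<close> and \<open>g 0\<close> that of
  \<open>g(w) / (1 - a w)\<close>. The substitution \<open>w = 1 / z\<close>, which reverses the circle, takes the one to the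
  other.\<close>

lemma holomorphic_disc_reflection:
  assumes f: "f holomorphic_on S" "open S" "cball 0 1 \<subseteq> S"
    and g: "g holomorphic_on T" "open T" "cball 0 1 \<subseteq> T"
    and eq: "\<And>z. norm z = 1 \<Longrightarrow> f z = g (1 / z)" and a: "norm a < 1"
  shows "f a = g 0"
proof -
  let ?\<gamma> = "circlepath 0 1"
  have \<gamma>: "norm (?\<gamma> t) = 1" "?\<gamma> t \<noteq> 0" for t by (auto simp: circlepath)
  have \<gamma>_rev: "?\<gamma> (1 - t) = 1 / ?\<gamma> t" for t
  proof -
    have "?\<gamma> (1 - t) = exp (2 * of_real pi * \<i> - 2 * of_real pi * \<i> * of_real t)"
      by (simp add: circlepath algebra_simps)
    also have "\<dots> = 1 / ?\<gamma> t" by (simp add: exp_diff circlepath)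
    finally show ?thesis .
  qed
  have f_int: "((\<lambda>t. f (?\<gamma> t) * ?\<gamma> t / (?\<gamma> t - a)) has_integral f a) {0..1}"
  proof -
    have "((\<lambda>u. f u / (u - a)) has_contour_integral (2 * of_real pi * \<i> * f a)) ?\<gamma>"
      by (rule Cauchy_integral_circlepath_simple)
        (use f a in \<open>auto intro: holomorphic_on_subset\<close>)
    then have "((\<lambda>t. f (?\<gamma> t) / (?\<gamma> t - a) * vector_derivative ?\<gamma> (at t within {0..1}))
        has_integral 2 * of_real pi * \<i> * f a) {0..1}"
      unfolding has_contour_integral_def .
    then have "((\<lambda>t. (2 * of_real pi * \<i>) * (f (?\<gamma> t) * ?\<gamma> t / (?\<gamma> t - a)))
        has_integral (2 * of_real pi * \<i>) * f a) {0..1}"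
    proof (rule has_integral_eq[rotated])
      fix t :: real assume "t \<in> {0..1}"
      then show "f (?\<gamma> t) / (?\<gamma> t - a) * vector_derivative ?\<gamma> (at t within {0..1}) =
          (2 * of_real pi * \<i>) * (f (?\<gamma> t) * ?\<gamma> t / (?\<gamma> t - a))"
        by (simp only: vector_derivative_circlepath_0) simp
    qed
    from has_integral_mult_right[OF this, of "1 / (2 * pi * \<i>)"] show ?thesis by simp
  qed
  have "((\<lambda>t. f (?\<gamma> (1 - t)) * ?\<gamma> (1 - t) / (?\<gamma> (1 - t) - a)) has_integral f a) {0..1}"
  proof -
    have "(-) 1 ` cbox 0 1 = cbox 0 (1::real)"
      unfolding box_real image_diff_atLeastAtMost by simp
    then show ?thesis
      using has_integral_affinity[OF f_int[folded box_real(2)], of "-1" 1] by simp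
  qed
  moreover have "f (?\<gamma> (1 - t)) * ?\<gamma> (1 - t) / (?\<gamma> (1 - t) - a) = g (?\<gamma> t) / (1 - a * ?\<gamma> t) / ?\<gamma> t ^ 0"
    for t
  proof -
    have 1: "1 / ?\<gamma> t - a = (1 - a * ?\<gamma> t) / ?\<gamma> t" using \<gamma>(2)[of t] by (simp add: diff_divide_distrib)
    have 2: "f (1 / ?\<gamma> t) = g (?\<gamma> t)" using eq[of "1 / ?\<gamma> t"] \<gamma>[of t] by (simp add: norm_divide)
    show ?thesis unfolding \<gamma>_rev 1 2 using \<gamma>(2)[of t] by simp
  qed
  moreover have "((\<lambda>t. g (?\<gamma> t) / (1 - a * ?\<gamma> t) / ?\<gamma> t ^ 0)
      has_integral (deriv ^^ 0) (\<lambda>u. g u / (1 - a * u)) 0 / fact 0) {0..1}"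
  proof (rule Cauchy_circle_integral)
    let ?U = "T \<inter> {u. 1 - a * u \<noteq> 0}"
    show "(\<lambda>u. g u / (1 - a * u)) holomorphic_on ?U"
      using g by (intro holomorphic_intros) (auto intro: holomorphic_on_subset)
    show "open ?U"
      by (intro open_Int g open_Collect_neq continuous_intros)
    have "a * u \<noteq> 1" if "norm u \<le> 1" for u
    proof
      assume "a * u = 1"
      then have "norm a * norm u = 1" by (metis norm_mult norm_one)
      moreover have "norm a * norm u \<le> norm a * 1" by (rule mult_left_mono) (use that in auto)
      ultimately show False using a by simp
    qed
    then show "cball 0 1 \<subseteq> ?U" using g by auto
  qed simp
  ultimately show "f a = g 0"
    by (simp add: has_integral_unique)
qed

text \<open>The form of Liouville's theorem behind the factorization: a function that is analytic inside
  the circle and, at the same time, analytic outside it, including infinity, is constant. The part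
  outside is described by its reflection \<open>H w = F (1 / w)\<close>.\<close>

lemma disc_analytic_reflection_const:
  fixes F H :: "complex \<Rightarrow> ('a::complex_normed_vector, 'b::complex_hilbert) cop"
  assumes F: "disc_analytic F" and H: "disc_analytic H"
    and eq: "\<And>z. norm z = 1 \<Longrightarrow> F z = H (1 / z)" and z: "norm z \<le> 1"
  shows "F z = H 0"
proof -
  obtain S where S: "open S" "cball 0 1 \<subseteq> S" "vec_analytic_on F S"
    using F unfolding disc_analytic_def by blast
  obtain T where T: "open T" "cball 0 1 \<subseteq> T" "vec_analytic_on H T"
    using H unfolding disc_analytic_def by blast
  have inner: "F a = H 0" if "a \<in> ball 0 1" for a
  proof (rule cop_eq_matrix_coeffI)
    fix x y
    show "matrix_coeff x y (F a) = matrix_coeff x y (H 0)"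
      by (rule holomorphic_disc_reflection[OF matrix_coeff_holomorphic[OF S(3)] S(1,2)
            matrix_coeff_holomorphic[OF T(3)] T(1,2)])
        (use eq that in auto)
  qed
  have "continuous_on S F"
    using S vec_differentiable_at_isCont continuous_at_imp_continuous_on
    unfolding vec_analytic_on_iff by blast
  then have "continuous_on (closure (ball 0 1)) F"
    using S by (simp add: continuous_on_subset)
  then show ?thesis
    by (rule continuous_constant_on_closure) (use inner z in auto)
qed

lemma vec_analytic_at_infinityI:
  assumes "r > 0" "\<And>w. norm w < r \<Longrightarrow> vec_differentiable_at H w"
    and "H 0 = L" "\<And>w. norm w < r \<Longrightarrow> w \<noteq> 0 \<Longrightarrow> F (1 / w) = H w"
  shows "vec_analytic_at_infinity F L"
  unfolding vec_analytic_at_infinity_def vec_analytic_on_iff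
proof (intro exI conjI ballI)
  fix z :: complex assume z: "z \<in> ball 0 r"
  have "\<forall>\<^sub>F w in nhds z. w \<in> ball 0 r"
    using z by (intro eventually_nhds_in_open) auto
  then have "\<forall>\<^sub>F w in nhds z. H w = (if w = 0 then L else F (1 / w))"
    by eventually_elim (use assms in auto)
  from vec_differentiable_at_cong[OF this]
  show "vec_differentiable_at (\<lambda>w. if w = 0 then L else F (1 / w)) z"
    using assms(2)[of z] z by simp
qed (rule assms)

lemma disc_analytic_reflection:
  assumes \<Omega>: "open \<Omega>" "- ball 0 1 \<subseteq> \<Omega>" "vec_analytic_on F \<Omega>"
    and inf: "vec_analytic_at_infinity F L"
  shows "disc_analytic (\<lambda>w. if w = 0 then L else F (1 / w))"
proof -
  let ?H = "\<lambda>w. if w = 0 then L else F (1 / w)"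
  obtain r where r: "r > 0" "vec_analytic_on ?H (ball 0 r)"
    using inf unfolding vec_analytic_at_infinity_def by blast
  define S where "S = (- {0}) \<inter> (\<lambda>w. 1 / w) -` \<Omega>"
  have S: "open S"
    unfolding S_def
    by (rule continuous_open_preimage) (use \<Omega> in \<open>auto intro!: continuous_intros\<close>)
  show ?thesis
  proof (rule disc_analyticI[of "S \<union> ball 0 r"])
    show "open (S \<union> ball 0 r)" using S by auto
    show "cball 0 1 \<subseteq> S \<union> ball 0 r"
    proof
      fix w :: complex assume w: "w \<in> cball 0 1"
      show "w \<in> S \<union> ball 0 r"
      proof (cases "w = 0")
        case False
        then have "1 / w \<in> - ball 0 1" using w by (simp add: norm_divide)
        then show ?thesis using \<Omega> False by (auto simp: S_def)
      qed (use r in simp)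
    qed
    fix w assume "w \<in> S \<union> ball 0 r"
    then show "vec_differentiable_at ?H w"
    proof
      assume w: "w \<in> S"
      then have "\<forall>\<^sub>F v in nhds w. v \<in> S" using S by (intro eventually_nhds_in_open)
      then have "\<forall>\<^sub>F v in nhds w. ?H v = F (1 / v)"
        by eventually_elim (simp add: S_def)
      moreover have "vec_differentiable_at (\<lambda>v. F (1 / v)) w"
        using w \<Omega>(3) by (intro vec_differentiable_at_inverse_arg) (auto simp: S_def vec_analytic_on_iff)
      ultimately show ?thesis by (rule vec_differentiable_at_cong[THEN iffD2])
    next
      assume "w \<in> ball 0 r"
      then show ?thesis using r(2) unfolding vec_analytic_on_iff by blast
    qed
  qed
qed

section \<open>Exponentially stable operators\<close>

lemma exponentially_stable_iff:
  "exponentially_stable A \<longleftrightarrow> (\<forall>z. norm z \<le> 1 \<longrightarrow> cop_invertible (cop_id - z *\<^sub>C A))"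
proof
  assume A: "exponentially_stable A"
  show "\<forall>z. norm z \<le> 1 \<longrightarrow> cop_invertible (cop_id - z *\<^sub>C A)"
  proof (intro allI impI)
    fix z :: complex assume z: "norm z \<le> 1"
    show "cop_invertible (cop_id - z *\<^sub>C A)"
    proof (cases "z = 0")
      case True
      then show ?thesis by (simp add: scaleC.zero_left)
    next
      case False
      then have "1 / z \<notin> ball 0 1" using z by (simp add: norm_divide)
      then have "cop_invertible ((1 / z) *\<^sub>C cop_id - A)"
        using A unfolding exponentially_stable_def cop_spectrum_def by blast
      then have "cop_invertible (z *\<^sub>C ((1 / z) *\<^sub>C cop_id - A))"
        using False by (rule cop_invertible_scaleC)
      then show ?thesis using False by (simp add: cop_algebra)
    qed
  qed
next
  assume A: "\<forall>z. norm z \<le> 1 \<longrightarrow> cop_invertible (cop_id - z *\<^sub>C A)"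
  have "cop_invertible (z *\<^sub>C cop_id - A)" if "z \<notin> ball 0 1" for z
  proof -
    have z: "z \<noteq> 0" using that by auto
    have "cop_invertible (cop_id - (1 / z) *\<^sub>C A)"
      using A that by (simp add: norm_divide divide_le_eq_1)
    then have "cop_invertible (z *\<^sub>C (cop_id - (1 / z) *\<^sub>C A))"
      using z by (rule cop_invertible_scaleC)
    then show ?thesis using z by (simp add: cop_algebra)
  qed
  then show "exponentially_stable A"
    unfolding exponentially_stable_def cop_spectrum_def by blast
qed

lemma cop_invertible_resolvent:
  assumes "z \<noteq> 0"
  shows "cop_invertible (z *\<^sub>C cop_id - A) \<longleftrightarrow> cop_invertible (cop_id - (1 / z) *\<^sub>C A)"
proof -
  have "z *\<^sub>C (cop_id - (1 / z) *\<^sub>C A) = z *\<^sub>C cop_id - A"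
    "(1 / z) *\<^sub>C (z *\<^sub>C cop_id - A) = cop_id - (1 / z) *\<^sub>C A"
    using assms by (simp_all add: scaleC_diff_right scaleC_scaleC)
  then show ?thesis
    using cop_invertible_scaleC[of "z *\<^sub>C cop_id - A" "1 / z"]
      cop_invertible_scaleC[of "cop_id - (1 / z) *\<^sub>C A" z] assms
    by auto
qed

lemma cop_inv_resolvent:
  assumes "z \<noteq> 0" "cop_invertible (cop_id - (1 / z) *\<^sub>C A)"
  shows "cop_inv (z *\<^sub>C cop_id - A) = (1 / z) *\<^sub>C cop_inv (cop_id - (1 / z) *\<^sub>C A)"
  using cop_inv_scaleC[OF assms(2,1)] assms(1) by (simp add: cop_algebra)

lemma open_cop_invertible_pencil:
  "open {z. cop_invertible (cop_id - z *\<^sub>C (A :: ('a::complex_hilbert, 'a) cop))}"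
  by (rule open_cop_invertible, rule vec_differentiable_at_isCont)
    (intro vec_differentiable_at_diff vec_differentiable_at_const vec_differentiable_at_ident)

lemma vec_differentiable_at_pencil_inv:
  fixes A :: "('a::complex_hilbert, 'a) cop"
  assumes "cop_invertible (cop_id - z *\<^sub>C A)"
  shows "vec_differentiable_at (\<lambda>w. cop_inv (cop_id - w *\<^sub>C A)) z"
  by (rule vec_differentiable_at_cop_inv[where F = "\<lambda>w. cop_id - w *\<^sub>C A", OF _ assms])
    (intro vec_differentiable_at_diff vec_differentiable_at_const vec_differentiable_at_ident)

lemma disc_analytic_pencil_inv:
  fixes A :: "('a::complex_hilbert, 'a) cop"
  assumes "exponentially_stable A"
  shows "disc_analytic (\<lambda>z. cop_inv (cop_id - z *\<^sub>C A))"
  by (rule disc_analyticI[OF open_cop_invertible_pencil[of A]])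
    (use assms in \<open>auto simp: exponentially_stable_iff vec_differentiable_at_pencil_inv\<close>)

text \<open>Decay of the powers: \<open>A ^ n\<close> is the \<open>n\<close>th Taylor coefficient of \<open>(I - z A)\<^sup>-\<^sup>1\<close>, which is
  analytic on a disc of radius larger than \<open>1\<close>.\<close>

lemma exponentially_stable_power_bound:
  fixes A :: "('a::complex_hilbert, 'a) cop"
  assumes "exponentially_stable A"
  obtains r M where "r > 1" "\<And>n. norm (cop_power A n) \<le> M / r ^ n"
proof -
  obtain a r M where r: "r > 1" and a: "\<And>n. norm (a n) \<le> M / r ^ n"
    "\<And>z. norm z < r \<Longrightarrow> (\<lambda>n. z ^ n *\<^sub>C a n) sums cop_inv (cop_id - z *\<^sub>C A)"
  proof (rule disc_analytic_power_series[OF disc_analytic_pencil_inv[OF assms]])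
  qed (rule that)
  \<comment> \<open>For \<open>norm z < s\<close> both the Taylor series and the Neumann series converge.\<close>
  define s where "s = min r (1 / (norm A + 1))"
  have pos: "norm A + 1 > 0" using norm_ge_zero[of A] by linarith
  then have "s > 0" using r by (simp add: s_def)
  have sums_zero: "(\<lambda>n. z ^ n *\<^sub>C (a n - cop_power A n)) sums 0" if z: "norm z < s" for z
  proof -
    have "norm z < 1 / (norm A + 1)" using z by (simp add: s_def)
    then have "norm z * (norm A + 1) < 1" using pos by (simp add: pos_less_divide_eq)
    then have "norm z * norm A < 1"
      using norm_ge_zero[of z] unfolding distrib_left mult_1_right by linarith
    then have "norm (z *\<^sub>C A) < 1" by (simp add: norm_scaleC)
    moreover have "norm z < r" using z by (simp add: s_def)
    ultimately have "(\<lambda>n. z ^ n *\<^sub>C a n - cop_power (z *\<^sub>C A) n) sums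
        (cop_inv (cop_id - z *\<^sub>C A) - cop_inv (cop_id - z *\<^sub>C A))"
      by (intro sums_diff a(2) neumann_sums)
    then show ?thesis by (simp only: cop_power_scaleC scaleC_diff_right diff_self)
  qed
  have "a n = cop_power A n" for n
  proof (rule cop_eq_matrix_coeffI)
    fix x y :: 'a
    interpret bounded_linear "matrix_coeff x y" by (rule bounded_linear_matrix_coeff)
    let ?c = "\<lambda>n. matrix_coeff x y (a n - cop_power A n)"
    have c: "(\<lambda>n. ?c n * (z - 0) ^ n) sums 0" if "norm (z - 0) < s" for z
    proof -
      have "(\<lambda>n. matrix_coeff x y (z ^ n *\<^sub>C (a n - cop_power A n))) sums matrix_coeff x y 0"
        by (rule sums[OF sums_zero]) (use that in simp)
      then show ?thesis by (simp only: matrix_coeff_scaleC zero mult.commute diff_zero)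
    qed
    have "?c n = 0"
    proof (rule ccontr)
      assume n: "?c n \<noteq> 0"
      show False
      proof (cases "n = 0")
        case True
        have "(\<lambda>n. ?c n * 0 ^ n) sums 0" using c[of 0] \<open>s > 0\<close> by simp
        then show ?thesis using n True by (simp only: powser_sums_zero_iff)
      next
        case False
        show ?thesis
        proof (rule powser_0_nonzero[OF \<open>s > 0\<close>, of 0 ?c "\<lambda>_. 0" n])
          show "(\<lambda>n. ?c n * (z - 0) ^ n) sums 0" if "norm (z - 0) < s" for z
            using that by (rule c)
          show "?c n \<noteq> 0" "n > 0" using n False by simp_all
          fix t :: real
          assume t: "0 < t" "\<And>z::complex. z \<in> cball 0 t - {0} \<Longrightarrow> (0::complex) \<noteq> 0"
          show False using t(1) t(2)[of "of_real t"] by simp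
        qed simp
      qed
    qed
    then show "matrix_coeff x y (a n) = matrix_coeff x y (cop_power A n)" by (simp add: diff)
  qed
  then show thesis using that[OF r, of M] a(1) by simp
qed

lemma exponentially_stable_power_bounded:
  fixes A :: "('a::complex_hilbert, 'a) cop"
  assumes "exponentially_stable A"
  obtains N where "N \<ge> 0" "\<And>n. norm (cop_power A n) \<le> N"
proof -
  obtain r M where r: "r > 1" and M: "\<And>n. norm (cop_power A n) \<le> M / r ^ n"
    using exponentially_stable_power_bound[OF assms] by blast
  have M0: "M \<ge> 0" using order_trans[OF norm_ge_zero M[of 0]] by simp
  have "norm (cop_power A n) \<le> M" for n
  proof -
    have "M / r ^ n \<le> M / 1" using M0 r by (intro divide_left_mono) auto
    then show ?thesis using M[of n] by simp
  qed
  then show thesis using that M0 by blast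
qed

lemma exponentially_stable_power_tendsto_zero:
  fixes A :: "('a::complex_hilbert, 'a) cop"
  assumes "exponentially_stable A"
  shows "cop_power A \<longlonglongrightarrow> 0"
proof -
  obtain r M where r: "r > 1" and M: "\<And>n. norm (cop_power A n) \<le> M / r ^ n"
    using exponentially_stable_power_bound[OF assms] by blast
  have "(\<lambda>n. M * (1 / r) ^ n) \<longlonglongrightarrow> M * 0"
    by (intro tendsto_mult tendsto_const LIMSEQ_realpow_zero) (use r in auto)
  then have "(\<lambda>n. M / r ^ n) \<longlonglongrightarrow> 0" by (simp add: power_divide)
  then show ?thesis by (rule Lim_null_comparison[rotated]) (simp add: M)
qed

section \<open>Stein equations and division by a linear pencil\<close>

text \<open>A Stein equation with exponentially stable coefficients is solved by the series
  \<open>\<Sum>n. A\<^sup>n X B\<^sup>n\<close>.\<close>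

lemma stein_equation_solvable:
  fixes A :: "('y::complex_hilbert, 'y) cop" and B :: "('x::complex_hilbert, 'x) cop"
    and X :: "('x, 'y) cop"
  assumes "exponentially_stable A" "exponentially_stable B"
  obtains Q where "Q = A \<cdot> Q \<cdot> B + X"
proof -
  obtain r M where r: "r > 1" and M: "\<And>n. norm (cop_power A n) \<le> M / r ^ n"
    using exponentially_stable_power_bound[OF assms(1)] by blast
  obtain N where N: "N \<ge> 0" "\<And>n. norm (cop_power B n) \<le> N"
    using exponentially_stable_power_bounded[OF assms(2)] by blast
  have M0: "M \<ge> 0" using order_trans[OF norm_ge_zero M[of 0]] by simp
  define t where "t n = cop_power A n \<cdot> X \<cdot> cop_power B n" for n
  have bound: "norm (t n) \<le> M * norm X * N * (1 / r) ^ n" for n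
  proof -
    have "norm (t n) \<le> norm (cop_power A n) * norm X * norm (cop_power B n)"
      unfolding t_def
      by (rule order_trans[OF norm_cop_compose mult_right_mono[OF norm_cop_compose norm_ge_zero]])
    also have "\<dots> \<le> (M / r ^ n) * norm X * N"
      using M N M0 r by (intro mult_mono) auto
    finally show ?thesis by (simp add: power_divide)
  qed
  have "summable (\<lambda>n. M * norm X * N * (1 / r) ^ n)"
    by (intro summable_mult summable_geometric) (use r in simp)
  then have sum: "summable t" by (rule summable_comparison_test'[of _ 0]) (rule bound)
  define Q where "Q = suminf t"
  have "Q = (\<Sum>n. t (Suc n)) + t 0" unfolding Q_def using suminf_split_head[OF sum] by simp
  also have "(\<lambda>n. t (Suc n)) = (\<lambda>n. A \<cdot> t n \<cdot> B)"
    unfolding t_def cop_power_Suc2[of B] by (simp add: cop_compose_assoc)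
  also have "(\<Sum>n. A \<cdot> t n \<cdot> B) = A \<cdot> Q \<cdot> B"
    unfolding Q_def
    by (rule bounded_linear.suminf[OF bounded_linear_compose[OF
          cop_compose.bounded_linear_left cop_compose.bounded_linear_right] sum, symmetric])
  finally show thesis using that by (simp add: t_def)
qed

lemma stein_equation_homogeneous:
  fixes A :: "('y::complex_hilbert, 'y) cop" and B :: "('x::complex_hilbert, 'x) cop"
  assumes "exponentially_stable A" "exponentially_stable B" and D: "D = A \<cdot> D \<cdot> B"
  shows "D = 0"
proof -
  have "(\<lambda>n. cop_power A n \<cdot> D \<cdot> cop_power B n) \<longlonglongrightarrow> 0 \<cdot> D \<cdot> 0"
    by (intro cop_compose.tendsto tendsto_const exponentially_stable_power_tendsto_zero assms)
  moreover have "cop_power A n \<cdot> D \<cdot> cop_power B n = D" for n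
  proof (induction n)
    case (Suc n)
    have "cop_power A (Suc n) \<cdot> D \<cdot> cop_power B (Suc n) = cop_power A n \<cdot> (A \<cdot> D \<cdot> B) \<cdot> cop_power B n"
      unfolding cop_power_Suc2[of A] by (simp add: cop_compose_assoc)
    then show ?case using Suc D by simp
  qed simp
  ultimately show ?thesis
    by (simp add: cop_compose.zero_left cop_compose.zero_right LIMSEQ_const_iff)
qed

text \<open>Division with remainder of \<open>G(w) \<gamma>\<close> by the pencil \<open>w - \<alpha>\<close>. The remainder is the value of
  \<open>G(w) \<gamma>\<close> at \<open>\<alpha>\<close> from the right, that is \<open>\<Sum>k. b\<^sub>k \<gamma> \<alpha>\<^sup>k\<close> if \<open>G(w) = \<Sum>k. w\<^sup>k b\<^sub>k\<close>.\<close>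

lemma disc_analytic_right_division:
  fixes G :: "complex \<Rightarrow> ('u::complex_normed_vector, 'v::complex_hilbert) cop"
    and \<gamma> :: "('x::complex_hilbert, 'u) cop" and \<alpha> :: "('x, 'x) cop"
  assumes G: "disc_analytic G" and \<alpha>: "exponentially_stable \<alpha>"
  obtains C E where "disc_analytic E"
    "\<And>w. norm w \<le> 1 \<Longrightarrow> G w \<cdot> \<gamma> = C + E w \<cdot> (w *\<^sub>C cop_id - \<alpha>)"
proof -
  obtain b r M where r: "r > 1" and b: "\<And>n. norm (b n) \<le> M / r ^ n"
    and sumG: "\<And>z. norm z < r \<Longrightarrow> (\<lambda>n. z ^ n *\<^sub>C b n) sums G z"
  proof (rule disc_analytic_power_series[OF G])
  qed (rule that)
  obtain N where N: "N \<ge> 0" "\<And>n. norm (cop_power \<alpha> n) \<le> N"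
    using exponentially_stable_power_bounded[OF \<alpha>] by blast
  have M0: "M \<ge> 0" using order_trans[OF norm_ge_zero b[of 0]] by simp
  define t where "t m i = b (Suc m + i) \<cdot> \<gamma> \<cdot> cop_power \<alpha> i" for m i
  define c where "c m = suminf (t m)" for m
  define L where "L = M * norm \<gamma> * N / r"
  have t_bound: "norm (t m i) \<le> L / r ^ m * (1 / r) ^ i" for m i
  proof -
    have "norm (t m i) \<le> norm (b (Suc m + i)) * norm \<gamma> * norm (cop_power \<alpha> i)"
      unfolding t_def
      by (rule order_trans[OF norm_cop_compose mult_right_mono[OF norm_cop_compose norm_ge_zero]])
    also have "\<dots> \<le> (M / r ^ (Suc m + i)) * norm \<gamma> * N"
      using M0 r by (intro mult_mono b N) auto
    also have "\<dots> = L / r ^ m * (1 / r) ^ i"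
      by (simp add: L_def power_add power_divide)
    finally show ?thesis .
  qed
  have geo: "summable (\<lambda>i. L / r ^ m * (1 / r) ^ i)" for m
    by (intro summable_mult summable_geometric) (use r in simp)
  have sum_norm_t: "summable (\<lambda>i. norm (t m i))" for m
    by (rule summable_comparison_test'[OF geo, of 0]) (use t_bound in simp)
  have sum_t: "summable (t m)" for m
    by (rule summable_norm_cancel[OF sum_norm_t])
  have c_bound: "norm (c m) \<le> L / (1 - 1 / r) / r ^ m" for m
  proof -
    have "norm (c m) \<le> (\<Sum>i. norm (t m i))"
      unfolding c_def by (rule summable_norm[OF sum_norm_t])
    also have "\<dots> \<le> (\<Sum>i. L / r ^ m * (1 / r) ^ i)"
      by (intro suminf_le t_bound sum_norm_t geo)
    also have "\<dots> = L / r ^ m * (1 / (1 - 1 / r))"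
      using r by (subst suminf_mult) (auto intro!: summable_geometric simp: suminf_geometric)
    finally show ?thesis by (simp add: mult.commute)
  qed
  \<comment> \<open>Coefficientwise form of the division: \<open>b\<^sub>m\<^sub>+\<^sub>1 \<gamma> = c\<^sub>m - c\<^sub>m\<^sub>+\<^sub>1 \<alpha>\<close>.\<close>
  have c_rec: "c m = b (Suc m) \<cdot> \<gamma> + c (Suc m) \<cdot> \<alpha>" for m
  proof -
    have "c m = (\<Sum>i. t m (Suc i)) + t m 0"
      unfolding c_def using suminf_split_head[OF sum_t] by simp
    also have "(\<lambda>i. t m (Suc i)) = (\<lambda>i. t (Suc m) i \<cdot> \<alpha>)"
      unfolding t_def cop_power_Suc2 by (simp add: cop_compose_assoc)
    also have "(\<Sum>i. t (Suc m) i \<cdot> \<alpha>) = c (Suc m) \<cdot> \<alpha>"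
      unfolding c_def by (rule bounded_linear.suminf[OF cop_compose.bounded_linear_left sum_t, symmetric])
    finally show ?thesis by (simp add: t_def)
  qed
  define E where "E w = (\<Sum>m. w ^ m *\<^sub>C c m)" for w
  have sumE: "(\<lambda>m. w ^ m *\<^sub>C c m) sums E w" if w: "norm w < r" for w
  proof -
    have sM: "summable (\<lambda>n. L / (1 - 1 / r) * (norm w / r) ^ n)"
      by (intro summable_mult summable_geometric) (use w r in simp)
    have "norm (w ^ n *\<^sub>C c n) \<le> L / (1 - 1 / r) * (norm w / r) ^ n" for n
      using mult_left_mono[OF c_bound[of n], of "norm w ^ n"]
      by (simp add: norm_scaleC norm_power power_divide mult.commute)
    then have "summable (\<lambda>n. w ^ n *\<^sub>C c n)"
      by (rule summable_comparison_test'[OF sM, of 0])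
    then show ?thesis unfolding E_def by (rule summable_sums)
  qed
  have "disc_analytic E"
  proof (rule disc_analyticI[of "ball 0 r"])
    show "vec_differentiable_at E z" if "z \<in> ball 0 r" for z
      by (rule vec_differentiable_at_power_series[OF c_bound _ sumE]) (use r that in auto)
  qed (use r in auto)
  moreover have "G w \<cdot> \<gamma> = (b 0 \<cdot> \<gamma> + c 0 \<cdot> \<alpha>) + E w \<cdot> (w *\<^sub>C cop_id - \<alpha>)" if w: "norm w \<le> 1" for w
  proof -
    have wr: "norm w < r" using w r by simp
    have 1: "(\<lambda>k. w ^ Suc k *\<^sub>C (b (Suc k) \<cdot> \<gamma>)) sums (G w \<cdot> \<gamma> - b 0 \<cdot> \<gamma>)"
      using bounded_linear.sums[OF cop_compose.bounded_linear_left sumG[OF wr], of \<gamma>]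
      by (subst sums_Suc_iff) (simp add: cop_compose_scaleC_left)
    have 2: "(\<lambda>k. w ^ Suc k *\<^sub>C (c (Suc k) \<cdot> \<alpha>)) sums (E w \<cdot> \<alpha> - c 0 \<cdot> \<alpha>)"
      using bounded_linear.sums[OF cop_compose.bounded_linear_left sumE[OF wr], of \<alpha>]
      by (subst sums_Suc_iff) (simp add: cop_compose_scaleC_left)
    have "(\<lambda>k. w *\<^sub>C (w ^ k *\<^sub>C c k)) sums (w *\<^sub>C E w)"
      by (rule bounded_linear.sums[OF scaleC.bounded_linear_right sumE[OF wr]])
    moreover have "w *\<^sub>C (w ^ k *\<^sub>C c k) =
        w ^ Suc k *\<^sub>C (b (Suc k) \<cdot> \<gamma>) + w ^ Suc k *\<^sub>C (c (Suc k) \<cdot> \<alpha>)" for k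
      using c_rec[of k] by (simp add: scaleC_scaleC flip: scaleC_add_right)
    ultimately have "w *\<^sub>C E w = (G w \<cdot> \<gamma> - b 0 \<cdot> \<gamma>) + (E w \<cdot> \<alpha> - c 0 \<cdot> \<alpha>)"
      using sums_unique2[OF _ sums_add[OF 1 2]] by simp
    then show ?thesis
      by (simp add: cop_compose.diff_right cop_compose_scaleC_right)
  qed
  ultimately show thesis by (rule that)
qed

section \<open>Uniqueness of the stabilizing solution\<close>

text \<open>The difference \<open>D\<close> of two solutions of the Riccati equation solves the homogeneous Stein
  equation \<open>D = \<alpha>\<^sub>-\<^sup>\<circ> D \<alpha>\<^sub>+\<^sup>\<circ>\<close>, in which \<open>\<alpha>\<^sub>-\<^sup>\<circ>\<close> is taken from the one solution and \<open>\<alpha>\<^sub>+\<^sup>\<circ>\<close> from the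
  other.\<close>

lemma stabilizing_solution_unique:
  assumes "stabilizing_solution \<delta> \<alpha>\<^sub>p \<beta>\<^sub>p \<gamma>\<^sub>p \<alpha>\<^sub>m \<beta>\<^sub>m \<gamma>\<^sub>m Q"
    and "stabilizing_solution \<delta> \<alpha>\<^sub>p \<beta>\<^sub>p \<gamma>\<^sub>p \<alpha>\<^sub>m \<beta>\<^sub>m \<gamma>\<^sub>m Q'"
  shows "Q = Q'"
proof -
  define D where "D = Q - Q'"
  define \<Delta> N M where "\<Delta> = \<delta> - \<gamma>\<^sub>m \<cdot> Q \<cdot> \<beta>\<^sub>p" and "N = \<gamma>\<^sub>p - \<gamma>\<^sub>m \<cdot> Q \<cdot> \<alpha>\<^sub>p" and "M = \<beta>\<^sub>m - \<alpha>\<^sub>m \<cdot> Q \<cdot> \<beta>\<^sub>p"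
  define \<Delta>' N' M' where "\<Delta>' = \<delta> - \<gamma>\<^sub>m \<cdot> Q' \<cdot> \<beta>\<^sub>p" and "N' = \<gamma>\<^sub>p - \<gamma>\<^sub>m \<cdot> Q' \<cdot> \<alpha>\<^sub>p"
    and "M' = \<beta>\<^sub>m - \<alpha>\<^sub>m \<cdot> Q' \<cdot> \<beta>\<^sub>p"
  have inv: "cop_invertible \<Delta>" "cop_invertible \<Delta>'"
    and ric: "Q = \<alpha>\<^sub>m \<cdot> Q \<cdot> \<alpha>\<^sub>p + M \<cdot> cop_inv \<Delta> \<cdot> N" "Q' = \<alpha>\<^sub>m \<cdot> Q' \<cdot> \<alpha>\<^sub>p + M' \<cdot> cop_inv \<Delta>' \<cdot> N'"
    and stable: "exponentially_stable (\<alpha>\<^sub>m - M \<cdot> cop_inv \<Delta> \<cdot> \<gamma>\<^sub>m)"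
      "exponentially_stable (\<alpha>\<^sub>p - \<beta>\<^sub>p \<cdot> cop_inv \<Delta>' \<cdot> N')"
    using assms unfolding stabilizing_solution_def alpha_circ_plus_def alpha_circ_minus_def
      \<Delta>_def N_def M_def \<Delta>'_def N'_def M'_def by blast+
  have diffs: "\<gamma>\<^sub>m \<cdot> D \<cdot> \<beta>\<^sub>p = \<Delta>' - \<Delta>" "\<gamma>\<^sub>m \<cdot> D \<cdot> \<alpha>\<^sub>p = N' - N" "\<alpha>\<^sub>m \<cdot> D \<cdot> \<beta>\<^sub>p = M' - M"
    unfolding D_def \<Delta>_def N_def M_def \<Delta>'_def N'_def M'_def by (simp_all add: cop_algebra)
  have "(\<alpha>\<^sub>m - M \<cdot> cop_inv \<Delta> \<cdot> \<gamma>\<^sub>m) \<cdot> D \<cdot> (\<alpha>\<^sub>p - \<beta>\<^sub>p \<cdot> cop_inv \<Delta>' \<cdot> N') =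
      \<alpha>\<^sub>m \<cdot> D \<cdot> \<alpha>\<^sub>p - (\<alpha>\<^sub>m \<cdot> D \<cdot> \<beta>\<^sub>p) \<cdot> cop_inv \<Delta>' \<cdot> N' - M \<cdot> cop_inv \<Delta> \<cdot> (\<gamma>\<^sub>m \<cdot> D \<cdot> \<alpha>\<^sub>p)
      + M \<cdot> cop_inv \<Delta> \<cdot> (\<gamma>\<^sub>m \<cdot> D \<cdot> \<beta>\<^sub>p) \<cdot> cop_inv \<Delta>' \<cdot> N'"
    by (simp add: cop_algebra)
  also have "\<dots> = \<alpha>\<^sub>m \<cdot> D \<cdot> \<alpha>\<^sub>p + M \<cdot> cop_inv \<Delta> \<cdot> N - M' \<cdot> cop_inv \<Delta>' \<cdot> N'"
    unfolding diffs using inv by (simp add: cop_algebra)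
  also have "\<dots> = (\<alpha>\<^sub>m \<cdot> Q \<cdot> \<alpha>\<^sub>p + M \<cdot> cop_inv \<Delta> \<cdot> N) - (\<alpha>\<^sub>m \<cdot> Q' \<cdot> \<alpha>\<^sub>p + M' \<cdot> cop_inv \<Delta>' \<cdot> N')"
    unfolding D_def by (simp add: cop_algebra)
  also have "\<dots> = D" unfolding D_def using ric by simp
  finally have "D = 0" by (intro stein_equation_homogeneous[OF stable]) simp
  then show ?thesis by (simp add: D_def)
qed

section \<open>The factors in state space form\<close>

lemma inner_factor_inverse:
  fixes \<alpha> :: "('x::complex_normed_vector, 'x) cop" and D :: "('u::complex_normed_vector, 'u) cop"
  assumes D: "cop_invertible D" and z: "cop_invertible (cop_id - z *\<^sub>C \<alpha>)"
    and V: "V = D + z *\<^sub>C (\<gamma> \<cdot> cop_inv (cop_id - z *\<^sub>C \<alpha>) \<cdot> \<beta>)"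
    and \<alpha>': "\<alpha>' = \<alpha> - \<beta> \<cdot> cop_inv D \<cdot> \<gamma>"
  shows "cop_invertible V \<longleftrightarrow> cop_invertible (cop_id - z *\<^sub>C \<alpha>')"
    and "cop_invertible V \<Longrightarrow> cop_inv V =
      cop_inv D - z *\<^sub>C (cop_inv D \<cdot> \<gamma> \<cdot> cop_inv (cop_id - z *\<^sub>C \<alpha>') \<cdot> \<beta> \<cdot> cop_inv D)"
proof -
  have V': "V = D + \<gamma> \<cdot> cop_inv (cop_id - z *\<^sub>C \<alpha>) \<cdot> (z *\<^sub>C \<beta>)"
    unfolding V by (simp add: cop_compose_scaleC_right)
  have P: "cop_id - z *\<^sub>C \<alpha>' = cop_id - z *\<^sub>C \<alpha> + (z *\<^sub>C \<beta>) \<cdot> cop_inv D \<cdot> \<gamma>"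
    unfolding \<alpha>' by (simp add: scaleC_diff_right cop_compose_scaleC_left)
  show iff: "cop_invertible V \<longleftrightarrow> cop_invertible (cop_id - z *\<^sub>C \<alpha>')"
    unfolding V' P using cop_invertible_woodbury[OF z D] cop_invertible_woodbury[OF D z] by blast
  show "cop_inv V =
      cop_inv D - z *\<^sub>C (cop_inv D \<cdot> \<gamma> \<cdot> cop_inv (cop_id - z *\<^sub>C \<alpha>') \<cdot> \<beta> \<cdot> cop_inv D)"
    if "cop_invertible V"
  proof -
    have "cop_invertible (cop_id - z *\<^sub>C \<alpha> + (z *\<^sub>C \<beta>) \<cdot> cop_inv D \<cdot> \<gamma>)"
      using that iff P by simp
    from cop_inv_woodbury[OF z D this] show ?thesis
      unfolding V' P by (simp only: cop_compose_scaleC_right cop_compose_scaleC_left)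
  qed
qed

lemma outer_factor_inverse:
  fixes \<alpha> :: "('y::complex_normed_vector, 'y) cop" and D :: "('u::complex_normed_vector, 'u) cop"
  assumes D: "cop_invertible D" and z: "cop_invertible (z *\<^sub>C cop_id - \<alpha>)"
    and V: "V = D + \<gamma> \<cdot> cop_inv (z *\<^sub>C cop_id - \<alpha>) \<cdot> \<beta>"
    and \<alpha>': "\<alpha>' = \<alpha> - \<beta> \<cdot> cop_inv D \<cdot> \<gamma>"
  shows "cop_invertible V \<longleftrightarrow> cop_invertible (z *\<^sub>C cop_id - \<alpha>')"
    and "cop_invertible V \<Longrightarrow> cop_inv V =
      cop_inv D - cop_inv D \<cdot> \<gamma> \<cdot> cop_inv (z *\<^sub>C cop_id - \<alpha>') \<cdot> \<beta> \<cdot> cop_inv D"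
proof -
  have P: "z *\<^sub>C cop_id - \<alpha>' = z *\<^sub>C cop_id - \<alpha> + \<beta> \<cdot> cop_inv D \<cdot> \<gamma>"
    unfolding \<alpha>' by simp
  show iff: "cop_invertible V \<longleftrightarrow> cop_invertible (z *\<^sub>C cop_id - \<alpha>')"
    unfolding V P using cop_invertible_woodbury[OF z D] cop_invertible_woodbury[OF D z] by blast
  show "cop_inv V = cop_inv D - cop_inv D \<cdot> \<gamma> \<cdot> cop_inv (z *\<^sub>C cop_id - \<alpha>') \<cdot> \<beta> \<cdot> cop_inv D"
    if "cop_invertible V"
    unfolding P V by (rule cop_inv_woodbury[OF z D]) (use that iff P in simp)
qed

lemma scaled_pencil_inv:
  assumes "cop_invertible (cop_id - z *\<^sub>C \<alpha>)"
  shows "z *\<^sub>C (\<alpha> \<cdot> cop_inv (cop_id - z *\<^sub>C \<alpha>)) = cop_inv (cop_id - z *\<^sub>C \<alpha>) - cop_id"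
proof -
  have "(cop_id - z *\<^sub>C \<alpha>) \<cdot> cop_inv (cop_id - z *\<^sub>C \<alpha>) = cop_id" using assms by simp
  then show ?thesis
    by (simp add: cop_compose.diff_left cop_compose_scaleC_left algebra_simps)
qed

text \<open>The product of the two resolvents on the left is resolved into a sum. Here \<open>Q\<close> is arbitrary; in
  the applications \<open>Q - \<alpha>\<^sub>- Q \<alpha>\<^sub>+\<close> factors through the space on which \<open>R\<close> acts.\<close>

lemma resolvent_product_split:
  assumes z: "cop_invertible (cop_id - z *\<^sub>C \<alpha>\<^sub>p)" "cop_invertible (z *\<^sub>C cop_id - \<alpha>\<^sub>m)"
  shows "cop_inv (z *\<^sub>C cop_id - \<alpha>\<^sub>m) \<cdot> ((\<beta>\<^sub>m - \<alpha>\<^sub>m \<cdot> Q \<cdot> \<beta>\<^sub>p) +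
      z *\<^sub>C ((Q - \<alpha>\<^sub>m \<cdot> Q \<cdot> \<alpha>\<^sub>p) \<cdot> cop_inv (cop_id - z *\<^sub>C \<alpha>\<^sub>p) \<cdot> \<beta>\<^sub>p)) =
    cop_inv (z *\<^sub>C cop_id - \<alpha>\<^sub>m) \<cdot> \<beta>\<^sub>m + Q \<cdot> cop_inv (cop_id - z *\<^sub>C \<alpha>\<^sub>p) \<cdot> \<beta>\<^sub>p"
proof -
  define P N where "P = cop_inv (cop_id - z *\<^sub>C \<alpha>\<^sub>p)" and "N = cop_inv (z *\<^sub>C cop_id - \<alpha>\<^sub>m)"
  have P: "z *\<^sub>C (\<alpha>\<^sub>p \<cdot> P) = P - cop_id"
    unfolding P_def by (rule scaled_pencil_inv[OF z(1)])
  have "N \<cdot> (z *\<^sub>C cop_id - \<alpha>\<^sub>m) = cop_id" unfolding N_def using z by simp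
  then have N: "N \<cdot> \<alpha>\<^sub>m = z *\<^sub>C N - cop_id"
    by (simp add: cop_compose.diff_right cop_compose_scaleC_right algebra_simps)
  have "N \<cdot> ((\<beta>\<^sub>m - \<alpha>\<^sub>m \<cdot> Q \<cdot> \<beta>\<^sub>p) + z *\<^sub>C ((Q - \<alpha>\<^sub>m \<cdot> Q \<cdot> \<alpha>\<^sub>p) \<cdot> P \<cdot> \<beta>\<^sub>p)) =
      N \<cdot> \<beta>\<^sub>m - (N \<cdot> \<alpha>\<^sub>m) \<cdot> Q \<cdot> \<beta>\<^sub>p + z *\<^sub>C (N \<cdot> Q \<cdot> P \<cdot> \<beta>\<^sub>p) - (N \<cdot> \<alpha>\<^sub>m) \<cdot> Q \<cdot> (z *\<^sub>C (\<alpha>\<^sub>p \<cdot> P)) \<cdot> \<beta>\<^sub>p"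
    by (simp add: cop_algebra)
  also have "\<dots> = N \<cdot> \<beta>\<^sub>m + Q \<cdot> P \<cdot> \<beta>\<^sub>p"
    unfolding P N by (simp add: cop_algebra)
  finally show ?thesis unfolding P_def N_def .
qed

section \<open>From a stabilizing solution to a factorization\<close>

lemma factorization_of_stabilizing_solution:
  fixes \<delta> :: "('u::complex_hilbert, 'u) cop" and \<alpha>\<^sub>p :: "('x::complex_hilbert, 'x) cop"
    and \<alpha>\<^sub>m :: "('y::complex_hilbert, 'y) cop"
  assumes rep: "stable_representation R \<delta> \<alpha>\<^sub>p \<beta>\<^sub>p \<gamma>\<^sub>p \<alpha>\<^sub>m \<beta>\<^sub>m \<gamma>\<^sub>m"
    and stab: "stabilizing_solution \<delta> \<alpha>\<^sub>p \<beta>\<^sub>p \<gamma>\<^sub>p \<alpha>\<^sub>m \<beta>\<^sub>m \<gamma>\<^sub>m Q"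
    and \<delta>: "cop_invertible \<delta>\<^sub>m" "cop_invertible \<delta>\<^sub>p" "\<delta>\<^sub>m \<cdot> \<delta>\<^sub>p = \<delta> - \<gamma>\<^sub>m \<cdot> Q \<cdot> \<beta>\<^sub>p"
    and \<gamma>': "\<gamma>' = cop_inv \<delta>\<^sub>m \<cdot> (\<gamma>\<^sub>p - \<gamma>\<^sub>m \<cdot> Q \<cdot> \<alpha>\<^sub>p)"
    and \<beta>': "\<beta>' = (\<beta>\<^sub>m - \<alpha>\<^sub>m \<cdot> Q \<cdot> \<beta>\<^sub>p) \<cdot> cop_inv \<delta>\<^sub>p"
    and Vm: "V\<^sub>m = (\<lambda>z. \<delta>\<^sub>m + \<gamma>\<^sub>m \<cdot> cop_inv (z *\<^sub>C cop_id - \<alpha>\<^sub>m) \<cdot> \<beta>')"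
    and Vp: "V\<^sub>p = (\<lambda>z. \<delta>\<^sub>p + z *\<^sub>C (\<gamma>' \<cdot> cop_inv (cop_id - z *\<^sub>C \<alpha>\<^sub>p) \<cdot> \<beta>\<^sub>p))"
  shows "right_canonical_factorization R V\<^sub>m V\<^sub>p"
    and "cop_invertible (cop_id - z *\<^sub>C \<alpha>\<^sub>p) \<Longrightarrow> cop_invertible (V\<^sub>p z) \<Longrightarrow>
      cop_invertible (cop_id - z *\<^sub>C alpha_circ_plus \<delta> \<alpha>\<^sub>p \<beta>\<^sub>p \<gamma>\<^sub>p \<gamma>\<^sub>m Q) \<and>
      cop_inv (V\<^sub>p z) = cop_inv \<delta>\<^sub>p - z *\<^sub>C (cop_inv \<delta>\<^sub>p \<cdot> \<gamma>' \<cdot>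
        cop_inv (cop_id - z *\<^sub>C alpha_circ_plus \<delta> \<alpha>\<^sub>p \<beta>\<^sub>p \<gamma>\<^sub>p \<gamma>\<^sub>m Q) \<cdot> \<beta>\<^sub>p \<cdot> cop_inv \<delta>\<^sub>p)"
    and "cop_invertible (z *\<^sub>C cop_id - \<alpha>\<^sub>m) \<Longrightarrow> cop_invertible (V\<^sub>m z) \<Longrightarrow>
      cop_invertible (z *\<^sub>C cop_id - alpha_circ_minus \<delta> \<beta>\<^sub>p \<alpha>\<^sub>m \<beta>\<^sub>m \<gamma>\<^sub>m Q) \<and>
      cop_inv (V\<^sub>m z) = cop_inv \<delta>\<^sub>m - cop_inv \<delta>\<^sub>m \<cdot> \<gamma>\<^sub>m \<cdot>
        cop_inv (z *\<^sub>C cop_id - alpha_circ_minus \<delta> \<beta>\<^sub>p \<alpha>\<^sub>m \<beta>\<^sub>m \<gamma>\<^sub>m Q) \<cdot> \<beta>' \<cdot> cop_inv \<delta>\<^sub>m"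
proof -
  define ap am where "ap = alpha_circ_plus \<delta> \<alpha>\<^sub>p \<beta>\<^sub>p \<gamma>\<^sub>p \<gamma>\<^sub>m Q"
    and "am = alpha_circ_minus \<delta> \<beta>\<^sub>p \<alpha>\<^sub>m \<beta>\<^sub>m \<gamma>\<^sub>m Q"
  have inv: "cop_inv (\<delta> - \<gamma>\<^sub>m \<cdot> Q \<cdot> \<beta>\<^sub>p) = cop_inv \<delta>\<^sub>p \<cdot> cop_inv \<delta>\<^sub>m"
    using cop_inv_compose[OF \<delta>(1,2)] \<delta>(3) by simp
  have ap: "ap = \<alpha>\<^sub>p - \<beta>\<^sub>p \<cdot> cop_inv \<delta>\<^sub>p \<cdot> \<gamma>'"
    unfolding ap_def alpha_circ_plus_def inv \<gamma>' by (simp add: cop_compose_assoc)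
  have am: "am = \<alpha>\<^sub>m - \<beta>' \<cdot> cop_inv \<delta>\<^sub>m \<cdot> \<gamma>\<^sub>m"
    unfolding am_def alpha_circ_minus_def inv \<beta>' by (simp add: cop_compose_assoc)
  have stable: "exponentially_stable \<alpha>\<^sub>p" "exponentially_stable \<alpha>\<^sub>m"
      "exponentially_stable ap" "exponentially_stable am"
    using rep stab unfolding stable_representation_def stabilizing_solution_def ap_def am_def by auto
  have \<beta>\<gamma>: "\<beta>' \<cdot> \<gamma>' = Q - \<alpha>\<^sub>m \<cdot> Q \<cdot> \<alpha>\<^sub>p"
  proof -
    have "Q = \<alpha>\<^sub>m \<cdot> Q \<cdot> \<alpha>\<^sub>p + (\<beta>\<^sub>m - \<alpha>\<^sub>m \<cdot> Q \<cdot> \<beta>\<^sub>p) \<cdot> cop_inv (\<delta> - \<gamma>\<^sub>m \<cdot> Q \<cdot> \<beta>\<^sub>p) \<cdot> (\<gamma>\<^sub>p - \<gamma>\<^sub>m \<cdot> Q \<cdot> \<alpha>\<^sub>p)"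
      using stab unfolding stabilizing_solution_def by blast
    also have "(\<beta>\<^sub>m - \<alpha>\<^sub>m \<cdot> Q \<cdot> \<beta>\<^sub>p) \<cdot> cop_inv (\<delta> - \<gamma>\<^sub>m \<cdot> Q \<cdot> \<beta>\<^sub>p) \<cdot> (\<gamma>\<^sub>p - \<gamma>\<^sub>m \<cdot> Q \<cdot> \<alpha>\<^sub>p) = \<beta>' \<cdot> \<gamma>'"
      unfolding inv \<beta>' \<gamma>' by (simp only: cop_compose_assoc)
    finally have "Q = \<alpha>\<^sub>m \<cdot> Q \<cdot> \<alpha>\<^sub>p + \<beta>' \<cdot> \<gamma>'" .
    then show ?thesis by (metis add_diff_cancel_left')
  qed
  have Vp_iff: "cop_invertible (V\<^sub>p z) \<longleftrightarrow> cop_invertible (cop_id - z *\<^sub>C ap)"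
    if "cop_invertible (cop_id - z *\<^sub>C \<alpha>\<^sub>p)" for z
    by (rule inner_factor_inverse(1)[OF \<delta>(2) that _ ap]) (simp add: Vp)
  have Vm_iff: "cop_invertible (V\<^sub>m z) \<longleftrightarrow> cop_invertible (z *\<^sub>C cop_id - am)"
    if "cop_invertible (z *\<^sub>C cop_id - \<alpha>\<^sub>m)" for z
    by (rule outer_factor_inverse(1)[OF \<delta>(1) that _ am]) (simp add: Vm)
  show "cop_invertible (cop_id - z *\<^sub>C ap) \<and>
      cop_inv (V\<^sub>p z) = cop_inv \<delta>\<^sub>p - z *\<^sub>C (cop_inv \<delta>\<^sub>p \<cdot> \<gamma>' \<cdot>
        cop_inv (cop_id - z *\<^sub>C ap) \<cdot> \<beta>\<^sub>p \<cdot> cop_inv \<delta>\<^sub>p)"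
    if "cop_invertible (cop_id - z *\<^sub>C \<alpha>\<^sub>p)" "cop_invertible (V\<^sub>p z)"
    using inner_factor_inverse(2)[OF \<delta>(2) that(1) _ ap that(2)] Vp_iff that by (simp add: Vp)
  show "cop_invertible (z *\<^sub>C cop_id - am) \<and>
      cop_inv (V\<^sub>m z) = cop_inv \<delta>\<^sub>m - cop_inv \<delta>\<^sub>m \<cdot> \<gamma>\<^sub>m \<cdot>
        cop_inv (z *\<^sub>C cop_id - am) \<cdot> \<beta>' \<cdot> cop_inv \<delta>\<^sub>m"
    if "cop_invertible (z *\<^sub>C cop_id - \<alpha>\<^sub>m)" "cop_invertible (V\<^sub>m z)"
    using outer_factor_inverse(2)[OF \<delta>(1) that(1) _ am that(2)] Vm_iff that by (simp add: Vm)
  have inner: "cop_invertible (cop_id - z *\<^sub>C \<alpha>\<^sub>p)" "cop_invertible (cop_id - z *\<^sub>C ap)"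
    if "norm z \<le> 1" for z
    using stable that by (simp_all add: exponentially_stable_iff)
  have outer: "cop_invertible (z *\<^sub>C cop_id - \<alpha>\<^sub>m)" "cop_invertible (z *\<^sub>C cop_id - am)"
    if "norm z \<ge> 1" for z
  proof -
    have z: "z \<noteq> 0" "norm (1 / z) \<le> 1" using that by (auto simp: norm_divide divide_le_eq_1)
    show "cop_invertible (z *\<^sub>C cop_id - \<alpha>\<^sub>m)" "cop_invertible (z *\<^sub>C cop_id - am)"
      using stable z by (simp_all add: exponentially_stable_iff cop_invertible_resolvent)
  qed
  have prod: "R z = V\<^sub>m z \<cdot> V\<^sub>p z" if z: "norm z = 1" for z
  proof -
    define P N where "P = cop_inv (cop_id - z *\<^sub>C \<alpha>\<^sub>p)" and "N = cop_inv (z *\<^sub>C cop_id - \<alpha>\<^sub>m)"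
    have iz: "cop_invertible (cop_id - z *\<^sub>C \<alpha>\<^sub>p)" "cop_invertible (z *\<^sub>C cop_id - \<alpha>\<^sub>m)"
      using inner outer z by simp_all
    have R: "R z = \<delta> + z *\<^sub>C (\<gamma>\<^sub>p \<cdot> P \<cdot> \<beta>\<^sub>p) + \<gamma>\<^sub>m \<cdot> N \<cdot> \<beta>\<^sub>m"
      using rep iz unfolding stable_representation_def P_def N_def by blast
    have P: "z *\<^sub>C (\<alpha>\<^sub>p \<cdot> P) = P - cop_id"
      unfolding P_def by (rule scaled_pencil_inv[OF iz(1)])
    have "\<delta>\<^sub>m \<cdot> V\<^sub>p z = \<delta>\<^sub>m \<cdot> \<delta>\<^sub>p + z *\<^sub>C ((\<gamma>\<^sub>p - \<gamma>\<^sub>m \<cdot> Q \<cdot> \<alpha>\<^sub>p) \<cdot> P \<cdot> \<beta>\<^sub>p)"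
      unfolding Vp P_def \<gamma>' using \<delta>
      by (simp add: cop_compose_add_right cop_compose_scaleC_right cop_compose_assoc)
    also have "\<dots> = \<delta> - \<gamma>\<^sub>m \<cdot> Q \<cdot> \<beta>\<^sub>p + z *\<^sub>C (\<gamma>\<^sub>p \<cdot> P \<cdot> \<beta>\<^sub>p) - \<gamma>\<^sub>m \<cdot> Q \<cdot> (z *\<^sub>C (\<alpha>\<^sub>p \<cdot> P)) \<cdot> \<beta>\<^sub>p"
      unfolding \<delta>(3) by (simp add: cop_algebra)
    also have "\<dots> = \<delta> + z *\<^sub>C (\<gamma>\<^sub>p \<cdot> P \<cdot> \<beta>\<^sub>p) - \<gamma>\<^sub>m \<cdot> Q \<cdot> P \<cdot> \<beta>\<^sub>p"
      unfolding P by (simp add: cop_algebra)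
    finally have 1: "\<delta>\<^sub>m \<cdot> V\<^sub>p z = \<delta> + z *\<^sub>C (\<gamma>\<^sub>p \<cdot> P \<cdot> \<beta>\<^sub>p) - \<gamma>\<^sub>m \<cdot> Q \<cdot> P \<cdot> \<beta>\<^sub>p" .
    have "\<beta>' \<cdot> V\<^sub>p z = (\<beta>\<^sub>m - \<alpha>\<^sub>m \<cdot> Q \<cdot> \<beta>\<^sub>p) + z *\<^sub>C ((\<beta>' \<cdot> \<gamma>') \<cdot> P \<cdot> \<beta>\<^sub>p)"
      unfolding Vp P_def \<beta>' using \<delta>
      by (simp add: cop_compose_add_right cop_compose_scaleC_right cop_compose_assoc)
    then have "N \<cdot> (\<beta>' \<cdot> V\<^sub>p z) = N \<cdot> \<beta>\<^sub>m + Q \<cdot> P \<cdot> \<beta>\<^sub>p"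
      using resolvent_product_split[OF iz] unfolding \<beta>\<gamma> P_def N_def by simp
    then have 2: "\<gamma>\<^sub>m \<cdot> N \<cdot> \<beta>' \<cdot> V\<^sub>p z = \<gamma>\<^sub>m \<cdot> N \<cdot> \<beta>\<^sub>m + \<gamma>\<^sub>m \<cdot> Q \<cdot> P \<cdot> \<beta>\<^sub>p"
      by (simp add: cop_compose_assoc cop_compose_add_right)
    have "V\<^sub>m z \<cdot> V\<^sub>p z = \<delta>\<^sub>m \<cdot> V\<^sub>p z + \<gamma>\<^sub>m \<cdot> N \<cdot> \<beta>' \<cdot> V\<^sub>p z"
      unfolding Vm N_def by (rule cop_compose_add_left)
    then show ?thesis unfolding 1 2 R by simp
  qed
  show "right_canonical_factorization R V\<^sub>m V\<^sub>p"
    unfolding right_canonical_factorization_def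
  proof (intro conjI ballI)
    show "R z = V\<^sub>m z \<cdot> V\<^sub>p z" if "z \<in> sphere 0 1" for z
      using prod that by simp
    let ?\<Omega>p = "{z. cop_invertible (cop_id - z *\<^sub>C \<alpha>\<^sub>p)} \<inter> {z. cop_invertible (cop_id - z *\<^sub>C ap)}"
    have dp: "vec_differentiable_at V\<^sub>p z" if "cop_invertible (cop_id - z *\<^sub>C \<alpha>\<^sub>p)" for z
      unfolding Vp
      by (intro vec_differentiable_at_add vec_differentiable_at_scale vec_differentiable_at_compose
          vec_differentiable_at_const vec_differentiable_at_pencil_inv that)
    show "\<exists>\<Omega>. open \<Omega> \<and> cball 0 1 \<subseteq> \<Omega> \<and> vec_analytic_on V\<^sub>p \<Omega> \<and> (\<forall>z\<in>\<Omega>. cop_invertible (V\<^sub>p z)) \<and>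
        vec_analytic_on (\<lambda>z. cop_inv (V\<^sub>p z)) \<Omega>"
      unfolding vec_analytic_on_iff
      by (rule exI[of _ ?\<Omega>p])
        (auto simp: inner Vp_iff intro!: open_Int open_cop_invertible_pencil dp
          vec_differentiable_at_cop_inv)
    let ?\<Omega>m = "{z. cop_invertible (z *\<^sub>C cop_id - \<alpha>\<^sub>m)} \<inter> {z. cop_invertible (z *\<^sub>C cop_id - am)}"
    have lin: "vec_differentiable_at (\<lambda>z. z *\<^sub>C cop_id - a) z" for a :: "('y, 'y) cop" and z
      by (intro vec_differentiable_at_diff vec_differentiable_at_const vec_differentiable_at_ident)
    have op: "open ?\<Omega>m"
      by (intro open_Int open_cop_invertible vec_differentiable_at_isCont lin)
    have dm: "vec_differentiable_at V\<^sub>m z" if "cop_invertible (z *\<^sub>C cop_id - \<alpha>\<^sub>m)" for z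
      unfolding Vm
      by (intro vec_differentiable_at_add vec_differentiable_at_compose
          vec_differentiable_at_const vec_differentiable_at_cop_inv lin that)
    define H where "H w = \<delta>\<^sub>m + w *\<^sub>C (\<gamma>\<^sub>m \<cdot> cop_inv (cop_id - w *\<^sub>C \<alpha>\<^sub>m) \<cdot> \<beta>')" for w
    have H: "V\<^sub>m (1 / w) = H w" if "norm w < 1" "w \<noteq> 0" for w
      unfolding Vm H_def
      using cop_inv_resolvent[of "1 / w" \<alpha>\<^sub>m] stable(2) that
      by (simp add: exponentially_stable_iff cop_algebra)
    have H0: "H 0 = \<delta>\<^sub>m" by (simp add: H_def scaleC.zero_left)
    have dH: "vec_differentiable_at H w" if "norm w < 1" for w
      unfolding H_def
      by (intro vec_differentiable_at_add vec_differentiable_at_scale vec_differentiable_at_compose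
          vec_differentiable_at_const vec_differentiable_at_pencil_inv)
        (use stable(2) that in \<open>simp add: exponentially_stable_iff\<close>)
    have invH: "cop_invertible (H w)" if w: "norm w < 1" for w
    proof (cases "w = 0")
      case False
      then have "norm (1 / w) \<ge> 1" using w by (simp add: norm_divide)
      then have "cop_invertible (V\<^sub>m (1 / w))" using Vm_iff outer by blast
      then show ?thesis using H w False by simp
    qed (simp add: H0 \<delta>)
    have inf: "vec_analytic_at_infinity V\<^sub>m \<delta>\<^sub>m"
      by (rule vec_analytic_at_infinityI[of 1 H]) (auto simp: dH H0 H)
    have inf': "vec_analytic_at_infinity (\<lambda>z. cop_inv (V\<^sub>m z)) (cop_inv \<delta>\<^sub>m)"
      by (rule vec_analytic_at_infinityI[of 1 "\<lambda>w. cop_inv (H w)"])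
        (auto simp: H0 H intro!: vec_differentiable_at_cop_inv dH invH)
    show "\<exists>\<Omega> L. open \<Omega> \<and> - ball 0 1 \<subseteq> \<Omega> \<and> vec_analytic_on V\<^sub>m \<Omega> \<and> (\<forall>z\<in>\<Omega>. cop_invertible (V\<^sub>m z)) \<and>
        vec_analytic_on (\<lambda>z. cop_inv (V\<^sub>m z)) \<Omega> \<and> vec_analytic_at_infinity V\<^sub>m L \<and> cop_invertible L \<and>
        vec_analytic_at_infinity (\<lambda>z. cop_inv (V\<^sub>m z)) (cop_inv L)"
      unfolding vec_analytic_on_iff
      by (rule exI[of _ ?\<Omega>m], rule exI[of _ \<delta>\<^sub>m])
        (use op inf inf' \<delta>(1) in \<open>auto simp: outer Vm_iff intro!: dm vec_differentiable_at_cop_inv\<close>)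
  qed
qed

section \<open>From a factorization to a stabilizing solution\<close>

text \<open>In the proof, \<open>L\<close> is the value of \<open>V\<^sub>-\<close> at infinity, so it plays the role of \<open>\<delta>\<^sub>-\<close>.\<close>

lemma stabilizing_solution_of_factorization:
  fixes \<delta> :: "('u::complex_hilbert, 'u) cop" and \<alpha>\<^sub>p :: "('x::complex_hilbert, 'x) cop"
    and \<alpha>\<^sub>m :: "('y::complex_hilbert, 'y) cop"
  assumes rep: "stable_representation R \<delta> \<alpha>\<^sub>p \<beta>\<^sub>p \<gamma>\<^sub>p \<alpha>\<^sub>m \<beta>\<^sub>m \<gamma>\<^sub>m"
    and fac: "right_canonical_factorization R V\<^sub>m V\<^sub>p"
  shows "\<exists>Q. stabilizing_solution \<delta> \<alpha>\<^sub>p \<beta>\<^sub>p \<gamma>\<^sub>p \<alpha>\<^sub>m \<beta>\<^sub>m \<gamma>\<^sub>m Q"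
proof -
  have stable: "exponentially_stable \<alpha>\<^sub>p" "exponentially_stable \<alpha>\<^sub>m"
    using rep unfolding stable_representation_def by auto
  obtain \<Omega>p where \<Omega>p: "open \<Omega>p" "cball 0 1 \<subseteq> \<Omega>p" "vec_analytic_on V\<^sub>p \<Omega>p"
      "\<forall>z\<in>\<Omega>p. cop_invertible (V\<^sub>p z)" "vec_analytic_on (\<lambda>z. cop_inv (V\<^sub>p z)) \<Omega>p"
    using fac unfolding right_canonical_factorization_def by blast
  obtain \<Omega>m L where \<Omega>m: "open \<Omega>m" "- ball 0 1 \<subseteq> \<Omega>m" "vec_analytic_on V\<^sub>m \<Omega>m"
      "\<forall>z\<in>\<Omega>m. cop_invertible (V\<^sub>m z)" "vec_analytic_on (\<lambda>z. cop_inv (V\<^sub>m z)) \<Omega>m"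
    and L: "vec_analytic_at_infinity V\<^sub>m L" "cop_invertible L"
      "vec_analytic_at_infinity (\<lambda>z. cop_inv (V\<^sub>m z)) (cop_inv L)"
    using fac unfolding right_canonical_factorization_def by blast
  \<comment> \<open>The reflections of \<open>V\<^sub>-\<close> and of its inverse.\<close>
  define H where "H = (\<lambda>w. if w = 0 then L else V\<^sub>m (1 / w))"
  define G where "G = (\<lambda>w. if w = 0 then cop_inv L else cop_inv (V\<^sub>m (1 / w)))"
  define A where "A z = cop_inv (V\<^sub>p z)" for z
  define P where "P z = cop_inv (cop_id - z *\<^sub>C \<alpha>\<^sub>p)" for z
  define N where "N w = cop_inv (cop_id - w *\<^sub>C \<alpha>\<^sub>m)" for w
  have disc: "disc_analytic V\<^sub>p" "disc_analytic A" "disc_analytic H" "disc_analytic G"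
      "disc_analytic P" "disc_analytic N"
  proof -
    show "disc_analytic V\<^sub>p" "disc_analytic A"
      using \<Omega>p unfolding disc_analytic_def A_def[abs_def] by blast+
    show "disc_analytic H" "disc_analytic G"
      unfolding H_def G_def
      using disc_analytic_reflection[OF \<Omega>m(1,2,3) L(1)]
        disc_analytic_reflection[OF \<Omega>m(1,2,5) L(3)] by blast+
    show "disc_analytic P" "disc_analytic N"
      unfolding P_def[abs_def] N_def[abs_def] by (rule disc_analytic_pencil_inv stable)+
  qed
  have iP: "cop_invertible (cop_id - z *\<^sub>C \<alpha>\<^sub>p)" and iN: "cop_invertible (cop_id - z *\<^sub>C \<alpha>\<^sub>m)"
    and iV: "cop_invertible (V\<^sub>p z)" if "norm z \<le> 1" for z
    using stable that \<Omega>p by (auto simp: exponentially_stable_iff)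
  have iH: "cop_invertible (H w)" and G: "G w = cop_inv (H w)" if "norm w \<le> 1" for w
  proof -
    have "1 / w \<in> - ball 0 1" if "w \<noteq> 0"
      using that \<open>norm w \<le> 1\<close> by (simp add: norm_divide)
    then show "cop_invertible (H w)" using L \<Omega>m by (auto simp: H_def)
    show "G w = cop_inv (H w)" by (simp add: G_def H_def)
  qed
  have R: "R z = \<delta> + z *\<^sub>C (\<gamma>\<^sub>p \<cdot> P z \<cdot> \<beta>\<^sub>p) + w *\<^sub>C (\<gamma>\<^sub>m \<cdot> N w \<cdot> \<beta>\<^sub>m)"
    and R_prod: "R z = H w \<cdot> V\<^sub>p z" if z: "norm z = 1" "w = 1 / z" for z w
  proof -
    have z0: "z \<noteq> 0" and w: "norm w \<le> 1" using z by (auto simp: norm_divide)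
    have "cop_invertible (z *\<^sub>C cop_id - \<alpha>\<^sub>m)"
      using cop_invertible_resolvent[OF z0, of \<alpha>\<^sub>m] iN[OF w] z by simp
    then have "R z = \<delta> + z *\<^sub>C (\<gamma>\<^sub>p \<cdot> P z \<cdot> \<beta>\<^sub>p) + \<gamma>\<^sub>m \<cdot> cop_inv (z *\<^sub>C cop_id - \<alpha>\<^sub>m) \<cdot> \<beta>\<^sub>m"
      using rep iP z unfolding stable_representation_def P_def by simp
    then show "R z = \<delta> + z *\<^sub>C (\<gamma>\<^sub>p \<cdot> P z \<cdot> \<beta>\<^sub>p) + w *\<^sub>C (\<gamma>\<^sub>m \<cdot> N w \<cdot> \<beta>\<^sub>m)"
      using cop_inv_resolvent[OF z0, of \<alpha>\<^sub>m] iN[OF w] z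
      by (simp add: N_def cop_compose_scaleC_left cop_compose_scaleC_right)
    show "R z = H w \<cdot> V\<^sub>p z"
      using fac z z0 unfolding right_canonical_factorization_def H_def by simp
  qed
  have pencil: "(w *\<^sub>C cop_id - \<alpha>\<^sub>p) \<cdot> P z = w *\<^sub>C cop_id" if z: "norm z = 1" "w = 1 / z" for z w
  proof -
    have z0: "z \<noteq> 0" using z by auto
    have "w *\<^sub>C cop_id - \<alpha>\<^sub>p = w *\<^sub>C (cop_id - z *\<^sub>C \<alpha>\<^sub>p)"
      using z0 z by (simp add: scaleC_diff_right scaleC_scaleC)
    then show ?thesis using iP[of z] z by (simp add: P_def cop_compose_scaleC_left)
  qed
  obtain C E where E: "disc_analytic E"
    and CE: "\<And>w. norm w \<le> 1 \<Longrightarrow> G w \<cdot> \<gamma>\<^sub>p = C + E w \<cdot> (w *\<^sub>C cop_id - \<alpha>\<^sub>p)"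
    using disc_analytic_right_division[OF disc(4) stable(1), of \<gamma>\<^sub>p] by blast

  \<comment> \<open>The inner factor: \<open>F1\<close> is analytic inside the circle, and \<open>K1\<close> continues it to the outside.\<close>
  define F1 where "F1 z = V\<^sub>p z - z *\<^sub>C (C \<cdot> P z \<cdot> \<beta>\<^sub>p)" for z
  define K1 where "K1 w = G w \<cdot> (\<delta> + w *\<^sub>C (\<gamma>\<^sub>m \<cdot> N w \<cdot> \<beta>\<^sub>m)) + E w \<cdot> \<beta>\<^sub>p" for w
  have disc1: "disc_analytic F1" "disc_analytic K1"
    unfolding F1_def[abs_def] K1_def[abs_def] by (intro disc_analytic_intros disc E)+
  have eq1: "F1 z = K1 (1 / z)" if z: "norm z = 1" for z
  proof -
    define w where "w = 1 / z"
    have w: "norm w \<le> 1" and zw: "z * w = 1" using z by (auto simp: w_def norm_divide)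
    have "V\<^sub>p z = G w \<cdot> R z"
      using R_prod[OF z w_def] iH[OF w] G[OF w] by simp
    also have "\<dots> = G w \<cdot> (\<delta> + w *\<^sub>C (\<gamma>\<^sub>m \<cdot> N w \<cdot> \<beta>\<^sub>m)) + z *\<^sub>C ((G w \<cdot> \<gamma>\<^sub>p) \<cdot> P z \<cdot> \<beta>\<^sub>p)"
      unfolding R[OF z w_def] by (simp add: cop_algebra)
    also have "(G w \<cdot> \<gamma>\<^sub>p) \<cdot> P z = C \<cdot> P z + w *\<^sub>C E w"
      unfolding CE[OF w] cop_compose_add_left cop_compose_assoc pencil[OF z w_def]
      by (simp add: cop_algebra)
    finally show ?thesis
      unfolding F1_def K1_def w_def[symmetric] by (simp add: cop_algebra zw)
  qed
  define \<delta>\<^sub>p where "\<delta>\<^sub>p = V\<^sub>p 0"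
  have i\<delta>: "cop_invertible \<delta>\<^sub>p" using iV[of 0] by (simp add: \<delta>\<^sub>p_def)
  have Vp: "V\<^sub>p z = \<delta>\<^sub>p + z *\<^sub>C (C \<cdot> P z \<cdot> \<beta>\<^sub>p)" if "norm z \<le> 1" for z
  proof -
    have "F1 z = F1 0"
      using disc_analytic_reflection_const[OF disc1 eq1] that by simp
    then show ?thesis by (simp add: F1_def \<delta>\<^sub>p_def scaleC.zero_left diff_eq_eq)
  qed

  define ap where "ap = \<alpha>\<^sub>p - \<beta>\<^sub>p \<cdot> cop_inv \<delta>\<^sub>p \<cdot> C"
  have stable_ap: "exponentially_stable ap"
    unfolding exponentially_stable_iff
    using inner_factor_inverse(1)[OF i\<delta> iP Vp[unfolded P_def] ap_def] iV by blast
  obtain Q where Q: "Q = \<alpha>\<^sub>m \<cdot> Q \<cdot> ap + \<beta>\<^sub>m \<cdot> cop_inv \<delta>\<^sub>p \<cdot> C"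
    using stein_equation_solvable[OF stable(2) stable_ap] by blast
  define B where "B = (\<beta>\<^sub>m - \<alpha>\<^sub>m \<cdot> Q \<cdot> \<beta>\<^sub>p) \<cdot> cop_inv \<delta>\<^sub>p"
  have B\<delta>: "B \<cdot> \<delta>\<^sub>p = \<beta>\<^sub>m - \<alpha>\<^sub>m \<cdot> Q \<cdot> \<beta>\<^sub>p"
    using i\<delta> by (simp add: B_def cop_compose_assoc)
  have "B \<cdot> C = (\<alpha>\<^sub>m \<cdot> Q \<cdot> ap + \<beta>\<^sub>m \<cdot> cop_inv \<delta>\<^sub>p \<cdot> C) - \<alpha>\<^sub>m \<cdot> Q \<cdot> \<alpha>\<^sub>p"
    by (simp add: B_def ap_def cop_algebra)
  then have BC: "B \<cdot> C = Q - \<alpha>\<^sub>m \<cdot> Q \<cdot> \<alpha>\<^sub>p" using Q by simp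

  \<comment> \<open>The outer factor, in the same way.\<close>
  define F2 where "F2 z = (\<delta> + (z *\<^sub>C \<gamma>\<^sub>p - \<gamma>\<^sub>m \<cdot> Q) \<cdot> P z \<cdot> \<beta>\<^sub>p) \<cdot> A z" for z
  define K2 where "K2 w = H w - w *\<^sub>C (\<gamma>\<^sub>m \<cdot> N w \<cdot> B)" for w
  have disc2: "disc_analytic F2" "disc_analytic K2"
    unfolding F2_def[abs_def] K2_def[abs_def] by (intro disc_analytic_intros disc)+
  have eq2: "F2 z = K2 (1 / z)" if z: "norm z = 1" for z
  proof -
    define w where "w = 1 / z"
    have z0: "z \<noteq> 0" and w: "norm w \<le> 1" using z by (auto simp: w_def norm_divide)
    have iz: "cop_invertible (cop_id - z *\<^sub>C \<alpha>\<^sub>p)" "cop_invertible (z *\<^sub>C cop_id - \<alpha>\<^sub>m)"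
      using iP iN[OF w] z cop_invertible_resolvent[OF z0, of \<alpha>\<^sub>m] by (simp_all add: w_def)
    have N: "cop_inv (z *\<^sub>C cop_id - \<alpha>\<^sub>m) = w *\<^sub>C N w"
      using cop_inv_resolvent[OF z0, of \<alpha>\<^sub>m] iN[OF w] by (simp add: w_def N_def)
    have "B \<cdot> V\<^sub>p z = (\<beta>\<^sub>m - \<alpha>\<^sub>m \<cdot> Q \<cdot> \<beta>\<^sub>p) + z *\<^sub>C ((Q - \<alpha>\<^sub>m \<cdot> Q \<cdot> \<alpha>\<^sub>p) \<cdot> P z \<cdot> \<beta>\<^sub>p)"
      unfolding BC[symmetric] B\<delta>[symmetric] using z
      by (simp add: Vp cop_compose_add_right cop_compose_scaleC_right cop_compose_assoc)
    then have BV: "w *\<^sub>C (N w \<cdot> (B \<cdot> V\<^sub>p z)) = w *\<^sub>C (N w \<cdot> \<beta>\<^sub>m) + Q \<cdot> P z \<cdot> \<beta>\<^sub>p"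
      using resolvent_product_split[OF iz, of \<beta>\<^sub>m Q \<beta>\<^sub>p]
      unfolding N P_def by (simp add: cop_compose_scaleC_left)
    have "K2 w \<cdot> V\<^sub>p z = R z - \<gamma>\<^sub>m \<cdot> (w *\<^sub>C (N w \<cdot> (B \<cdot> V\<^sub>p z)))"
      unfolding K2_def R_prod[OF z w_def] by (simp add: cop_algebra)
    also have "\<dots> = \<delta> + (z *\<^sub>C \<gamma>\<^sub>p - \<gamma>\<^sub>m \<cdot> Q) \<cdot> P z \<cdot> \<beta>\<^sub>p"
      unfolding BV R[OF z w_def] by (simp add: cop_algebra)
    finally have "K2 w \<cdot> V\<^sub>p z \<cdot> A z = F2 z" unfolding F2_def by simp
    then show ?thesis
      using iV[of z] z by (simp add: A_def w_def cop_compose_assoc)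
  qed
  have eq2': "K2 w = F2 (1 / w)" if "norm w = 1" for w
    using eq2[of "1 / w"] that by (simp add: norm_divide)
  have K2: "K2 w = F2 0" if "norm w \<le> 1" for w
    by (rule disc_analytic_reflection_const[OF disc2(2,1) eq2' that])
  have F20: "F2 0 = (\<delta> - \<gamma>\<^sub>m \<cdot> Q \<cdot> \<beta>\<^sub>p) \<cdot> cop_inv \<delta>\<^sub>p"
    by (simp add: F2_def A_def P_def \<delta>\<^sub>p_def scaleC.zero_left cop_compose.minus_left)
  have LF2: "L = F2 0"
    using K2[of 0] by (simp add: K2_def H_def scaleC.zero_left)
  have L\<delta>: "L \<cdot> \<delta>\<^sub>p = \<delta> - \<gamma>\<^sub>m \<cdot> Q \<cdot> \<beta>\<^sub>p"
    unfolding LF2 F20 using i\<delta> by (simp add: cop_compose_assoc)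
  have H: "H w = L + w *\<^sub>C (\<gamma>\<^sub>m \<cdot> N w \<cdot> B)" if "norm w \<le> 1" for w
    using K2[OF that] LF2 by (simp add: K2_def diff_eq_eq)

  \<comment> \<open>The identity \<open>\<delta>\<^sub>- C = \<gamma>\<^sub>+ - \<gamma>\<^sub>- Q \<alpha>\<^sub>+\<close>. Comparing the factors with \<open>R\<close> would only give it after
    multiplication by \<open>\<alpha>\<^sub>+\<^sup>k \<beta>\<^sub>+\<close> from the right.\<close>
  define K where "K = \<gamma>\<^sub>p - L \<cdot> C - \<gamma>\<^sub>m \<cdot> Q \<cdot> \<alpha>\<^sub>p"
  define S where "S w = H w \<cdot> E w + \<gamma>\<^sub>m \<cdot> N w \<cdot> Q" for w
  have K_eq: "K = S w \<cdot> (w *\<^sub>C cop_id - \<alpha>\<^sub>p)" if w: "norm w \<le> 1" for w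
  proof -
    have "N w \<cdot> (cop_id - w *\<^sub>C \<alpha>\<^sub>m) = cop_id" using iN[OF w] by (simp add: N_def)
    then have N\<alpha>: "w *\<^sub>C (N w \<cdot> \<alpha>\<^sub>m) = N w - cop_id"
      by (simp add: cop_compose.diff_right cop_compose_scaleC_right algebra_simps)
    have "\<gamma>\<^sub>p = H w \<cdot> (G w \<cdot> \<gamma>\<^sub>p)" using iH[OF w] G[OF w] by simp
    also have "\<dots> = H w \<cdot> C + H w \<cdot> E w \<cdot> (w *\<^sub>C cop_id - \<alpha>\<^sub>p)"
      unfolding CE[OF w] by (simp add: cop_compose_add_right cop_compose_assoc)
    also have "H w \<cdot> C = L \<cdot> C + w *\<^sub>C (\<gamma>\<^sub>m \<cdot> N w \<cdot> (B \<cdot> C))"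
      unfolding H[OF w] by (simp add: cop_compose_add_left cop_compose_scaleC_left cop_compose_assoc)
    also have "w *\<^sub>C (\<gamma>\<^sub>m \<cdot> N w \<cdot> (B \<cdot> C)) =
        w *\<^sub>C (\<gamma>\<^sub>m \<cdot> N w \<cdot> Q) - \<gamma>\<^sub>m \<cdot> (w *\<^sub>C (N w \<cdot> \<alpha>\<^sub>m)) \<cdot> Q \<cdot> \<alpha>\<^sub>p"
      unfolding BC by (simp add: cop_algebra)
    also have "\<dots> = \<gamma>\<^sub>m \<cdot> Q \<cdot> \<alpha>\<^sub>p + \<gamma>\<^sub>m \<cdot> N w \<cdot> Q \<cdot> (w *\<^sub>C cop_id - \<alpha>\<^sub>p)"
      unfolding N\<alpha> by (simp add: cop_algebra)
    finally have *: "\<gamma>\<^sub>p = L \<cdot> C + (\<gamma>\<^sub>m \<cdot> Q \<cdot> \<alpha>\<^sub>p + \<gamma>\<^sub>m \<cdot> N w \<cdot> Q \<cdot> (w *\<^sub>C cop_id - \<alpha>\<^sub>p)) +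
        H w \<cdot> E w \<cdot> (w *\<^sub>C cop_id - \<alpha>\<^sub>p)" .
    show ?thesis
      unfolding K_def S_def cop_compose_add_left by (subst *) simp
  qed
  have "K \<cdot> P 0 = 0 *\<^sub>C S 0"
  proof (rule disc_analytic_reflection_const)
    show "disc_analytic (\<lambda>z. K \<cdot> P z)" "disc_analytic (\<lambda>w. w *\<^sub>C S w)"
      unfolding S_def by (intro disc_analytic_intros disc E)+
    fix z :: complex assume z: "norm z = 1"
    then have "norm (1 / z) \<le> 1" by (simp add: norm_divide)
    from K_eq[OF this] have "K \<cdot> P z = S (1 / z) \<cdot> (((1 / z) *\<^sub>C cop_id - \<alpha>\<^sub>p) \<cdot> P z)"
      by (simp only: cop_compose_assoc)
    then show "K \<cdot> P z = (1 / z) *\<^sub>C S (1 / z)"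
      unfolding pencil[OF z refl] by (simp add: cop_compose_scaleC_right)
  qed simp
  then have "K = 0" by (simp add: P_def scaleC.zero_left)
  then have LC: "L \<cdot> C = \<gamma>\<^sub>p - \<gamma>\<^sub>m \<cdot> Q \<cdot> \<alpha>\<^sub>p" by (simp add: K_def algebra_simps)

  define am where "am = \<alpha>\<^sub>m - B \<cdot> cop_inv L \<cdot> \<gamma>\<^sub>m"
  have stable_am: "exponentially_stable am"
    unfolding exponentially_stable_iff
    using inner_factor_inverse(1)[OF L(2) iN H[unfolded N_def] am_def] iH by blast
  have inv: "cop_inv (\<delta> - \<gamma>\<^sub>m \<cdot> Q \<cdot> \<beta>\<^sub>p) = cop_inv \<delta>\<^sub>p \<cdot> cop_inv L"
    unfolding L\<delta>[symmetric] by (rule cop_inv_compose[OF L(2) i\<delta>])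
  show ?thesis
  proof (rule exI[of _ Q], unfold stabilizing_solution_def, intro conjI)
    show "cop_invertible (\<delta> - \<gamma>\<^sub>m \<cdot> Q \<cdot> \<beta>\<^sub>p)"
      unfolding L\<delta>[symmetric] by (rule cop_invertible_compose[OF L(2) i\<delta>])
    have "B \<cdot> \<delta>\<^sub>p \<cdot> (cop_inv \<delta>\<^sub>p \<cdot> cop_inv L) \<cdot> (L \<cdot> C) = B \<cdot> C"
      using i\<delta> L by (simp add: cop_compose_assoc)
    then show "Q = \<alpha>\<^sub>m \<cdot> Q \<cdot> \<alpha>\<^sub>p + (\<beta>\<^sub>m - \<alpha>\<^sub>m \<cdot> Q \<cdot> \<beta>\<^sub>p) \<cdot> cop_inv (\<delta> - \<gamma>\<^sub>m \<cdot> Q \<cdot> \<beta>\<^sub>p) \<cdot> (\<gamma>\<^sub>p - \<gamma>\<^sub>m \<cdot> Q \<cdot> \<alpha>\<^sub>p)"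
      unfolding inv B\<delta>[symmetric] LC[symmetric] using BC by simp
    have "alpha_circ_plus \<delta> \<alpha>\<^sub>p \<beta>\<^sub>p \<gamma>\<^sub>p \<gamma>\<^sub>m Q = ap"
      unfolding alpha_circ_plus_def inv LC[symmetric] ap_def using L by (simp add: cop_compose_assoc)
    then show "exponentially_stable (alpha_circ_plus \<delta> \<alpha>\<^sub>p \<beta>\<^sub>p \<gamma>\<^sub>p \<gamma>\<^sub>m Q)" using stable_ap by simp
    have "alpha_circ_minus \<delta> \<beta>\<^sub>p \<alpha>\<^sub>m \<beta>\<^sub>m \<gamma>\<^sub>m Q = am"
      unfolding alpha_circ_minus_def inv B\<delta>[symmetric] am_def using i\<delta> by (simp add: cop_compose_assoc)
    then show "exponentially_stable (alpha_circ_minus \<delta> \<beta>\<^sub>p \<alpha>\<^sub>m \<beta>\<^sub>m \<gamma>\<^sub>m Q)" using stable_am by simp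
  qed
qed

section \<open>Wiener-Hopf factorization and the Riccati equation\<close>

theorem theorem2p1:
  fixes R :: "complex \<Rightarrow> ('u::complex_hilbert, 'u) cop"
    and \<delta> :: "('u, 'u) cop"
    and \<alpha>\<^sub>p :: "('x::complex_hilbert, 'x) cop"
    and \<beta>\<^sub>p :: "('u, 'x) cop"
    and \<gamma>\<^sub>p :: "('x, 'u) cop"
    and \<alpha>\<^sub>m :: "('y::complex_hilbert, 'y) cop"
    and \<beta>\<^sub>m :: "('u, 'y) cop"
    and \<gamma>\<^sub>m :: "('y, 'u) cop"
    and \<Omega> :: "complex set"
  assumes "stable_representation R \<delta> \<alpha>\<^sub>p \<beta>\<^sub>p \<gamma>\<^sub>p \<alpha>\<^sub>m \<beta>\<^sub>m \<gamma>\<^sub>m"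
    and "open \<Omega>" and "sphere 0 1 \<subseteq> \<Omega>"
    and "vec_analytic_on R \<Omega>" and "\<forall>z\<in>\<Omega>. cop_invertible (R z)"
  shows
    "((\<exists>V\<^sub>m V\<^sub>p. right_canonical_factorization R V\<^sub>m V\<^sub>p) \<longleftrightarrow>
      (\<exists>Q :: ('x, 'y) cop. stabilizing_solution \<delta> \<alpha>\<^sub>p \<beta>\<^sub>p \<gamma>\<^sub>p \<alpha>\<^sub>m \<beta>\<^sub>m \<gamma>\<^sub>m Q)) \<and>
     (\<forall>Q Q' :: ('x, 'y) cop.
        stabilizing_solution \<delta> \<alpha>\<^sub>p \<beta>\<^sub>p \<gamma>\<^sub>p \<alpha>\<^sub>m \<beta>\<^sub>m \<gamma>\<^sub>m Q \<and>
        stabilizing_solution \<delta> \<alpha>\<^sub>p \<beta>\<^sub>p \<gamma>\<^sub>p \<alpha>\<^sub>m \<beta>\<^sub>m \<gamma>\<^sub>m Q' \<longrightarrow> Q = Q') \<and>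
     (\<forall>(Q :: ('x, 'y) cop) (\<delta>\<^sub>m :: ('u, 'u) cop) (\<delta>\<^sub>p :: ('u, 'u) cop)
        (\<gamma>' :: ('x, 'u) cop) (\<beta>' :: ('u, 'y) cop) V\<^sub>m V\<^sub>p.
        stabilizing_solution \<delta> \<alpha>\<^sub>p \<beta>\<^sub>p \<gamma>\<^sub>p \<alpha>\<^sub>m \<beta>\<^sub>m \<gamma>\<^sub>m Q \<and>
        cop_invertible \<delta>\<^sub>m \<and> cop_invertible \<delta>\<^sub>p \<and> \<delta>\<^sub>m \<cdot> \<delta>\<^sub>p = \<delta> - \<gamma>\<^sub>m \<cdot> Q \<cdot> \<beta>\<^sub>p \<and>
        \<gamma>' = cop_inv \<delta>\<^sub>m \<cdot> (\<gamma>\<^sub>p - \<gamma>\<^sub>m \<cdot> Q \<cdot> \<alpha>\<^sub>p) \<and>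
        \<beta>' = (\<beta>\<^sub>m - \<alpha>\<^sub>m \<cdot> Q \<cdot> \<beta>\<^sub>p) \<cdot> cop_inv \<delta>\<^sub>p \<and>
        V\<^sub>m = (\<lambda>z. \<delta>\<^sub>m + \<gamma>\<^sub>m \<cdot> cop_inv (z *\<^sub>C cop_id - \<alpha>\<^sub>m) \<cdot> \<beta>') \<and>
        V\<^sub>p = (\<lambda>z. \<delta>\<^sub>p + z *\<^sub>C (\<gamma>' \<cdot> cop_inv (cop_id - z *\<^sub>C \<alpha>\<^sub>p) \<cdot> \<beta>\<^sub>p)) \<longrightarrow>
        right_canonical_factorization R V\<^sub>m V\<^sub>p \<and>
        (\<forall>z. cop_invertible (cop_id - z *\<^sub>C \<alpha>\<^sub>p) \<and> cop_invertible (V\<^sub>p z) \<longrightarrow>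
           cop_invertible (cop_id - z *\<^sub>C alpha_circ_plus \<delta> \<alpha>\<^sub>p \<beta>\<^sub>p \<gamma>\<^sub>p \<gamma>\<^sub>m Q) \<and>
           cop_inv (V\<^sub>p z) =
             cop_inv \<delta>\<^sub>p - z *\<^sub>C (cop_inv \<delta>\<^sub>p \<cdot> \<gamma>' \<cdot>
               cop_inv (cop_id - z *\<^sub>C alpha_circ_plus \<delta> \<alpha>\<^sub>p \<beta>\<^sub>p \<gamma>\<^sub>p \<gamma>\<^sub>m Q) \<cdot> \<beta>\<^sub>p \<cdot> cop_inv \<delta>\<^sub>p)) \<and>
        (\<forall>z. cop_invertible (z *\<^sub>C cop_id - \<alpha>\<^sub>m) \<and> cop_invertible (V\<^sub>m z) \<longrightarrow>
           cop_invertible (z *\<^sub>C cop_id - alpha_circ_minus \<delta> \<beta>\<^sub>p \<alpha>\<^sub>m \<beta>\<^sub>m \<gamma>\<^sub>m Q) \<and>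
           cop_inv (V\<^sub>m z) =
             cop_inv \<delta>\<^sub>m - cop_inv \<delta>\<^sub>m \<cdot> \<gamma>\<^sub>m \<cdot>
               cop_inv (z *\<^sub>C cop_id - alpha_circ_minus \<delta> \<beta>\<^sub>p \<alpha>\<^sub>m \<beta>\<^sub>m \<gamma>\<^sub>m Q) \<cdot> \<beta>' \<cdot> cop_inv \<delta>\<^sub>m))"
proof (intro conjI allI impI iffI; (elim conjE)?)
  assume "\<exists>V\<^sub>m V\<^sub>p. right_canonical_factorization R V\<^sub>m V\<^sub>p"
  then show "\<exists>Q. stabilizing_solution \<delta> \<alpha>\<^sub>p \<beta>\<^sub>p \<gamma>\<^sub>p \<alpha>\<^sub>m \<beta>\<^sub>m \<gamma>\<^sub>m Q"
    using stabilizing_solution_of_factorization[OF assms(1)] by blast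
next
  assume "\<exists>Q. stabilizing_solution \<delta> \<alpha>\<^sub>p \<beta>\<^sub>p \<gamma>\<^sub>p \<alpha>\<^sub>m \<beta>\<^sub>m \<gamma>\<^sub>m Q"
  then obtain Q where Q: "stabilizing_solution \<delta> \<alpha>\<^sub>p \<beta>\<^sub>p \<gamma>\<^sub>p \<alpha>\<^sub>m \<beta>\<^sub>m \<gamma>\<^sub>m Q" by blast
  then have "cop_invertible (\<delta> - \<gamma>\<^sub>m \<cdot> Q \<cdot> \<beta>\<^sub>p)" unfolding stabilizing_solution_def by blast
  from factorization_of_stabilizing_solution(1)[OF assms(1) Q this cop_invertible_id cop_id_right
      refl refl refl refl]
  show "\<exists>V\<^sub>m V\<^sub>p. right_canonical_factorization R V\<^sub>m V\<^sub>p" by blast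
next
  fix Q Q'
  assume "stabilizing_solution \<delta> \<alpha>\<^sub>p \<beta>\<^sub>p \<gamma>\<^sub>p \<alpha>\<^sub>m \<beta>\<^sub>m \<gamma>\<^sub>m Q" "stabilizing_solution \<delta> \<alpha>\<^sub>p \<beta>\<^sub>p \<gamma>\<^sub>p \<alpha>\<^sub>m \<beta>\<^sub>m \<gamma>\<^sub>m Q'"
  then show "Q = Q'" by (rule stabilizing_solution_unique)
next
  fix Q :: "('x, 'y) cop" and \<delta>\<^sub>m \<delta>\<^sub>p :: "('u, 'u) cop"
    and \<gamma>' :: "('x, 'u) cop" and \<beta>' :: "('u, 'y) cop" and V\<^sub>m V\<^sub>p
  assume "stabilizing_solution \<delta> \<alpha>\<^sub>p \<beta>\<^sub>p \<gamma>\<^sub>p \<alpha>\<^sub>m \<beta>\<^sub>m \<gamma>\<^sub>m Q"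
    and "cop_invertible \<delta>\<^sub>m" "cop_invertible \<delta>\<^sub>p" "\<delta>\<^sub>m \<cdot> \<delta>\<^sub>p = \<delta> - \<gamma>\<^sub>m \<cdot> Q \<cdot> \<beta>\<^sub>p"
    and "\<gamma>' = cop_inv \<delta>\<^sub>m \<cdot> (\<gamma>\<^sub>p - \<gamma>\<^sub>m \<cdot> Q \<cdot> \<alpha>\<^sub>p)"
    and "\<beta>' = (\<beta>\<^sub>m - \<alpha>\<^sub>m \<cdot> Q \<cdot> \<beta>\<^sub>p) \<cdot> cop_inv \<delta>\<^sub>p"
    and "V\<^sub>m = (\<lambda>z. \<delta>\<^sub>m + \<gamma>\<^sub>m \<cdot> cop_inv (z *\<^sub>C cop_id - \<alpha>\<^sub>m) \<cdot> \<beta>')"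
    and "V\<^sub>p = (\<lambda>z. \<delta>\<^sub>p + z *\<^sub>C (\<gamma>' \<cdot> cop_inv (cop_id - z *\<^sub>C \<alpha>\<^sub>p) \<cdot> \<beta>\<^sub>p))"
  note fac = factorization_of_stabilizing_solution[OF assms(1) this]
  show "right_canonical_factorization R V\<^sub>m V\<^sub>p" by (rule fac(1))
  fix z
  show "cop_invertible (cop_id - z *\<^sub>C alpha_circ_plus \<delta> \<alpha>\<^sub>p \<beta>\<^sub>p \<gamma>\<^sub>p \<gamma>\<^sub>m Q)"
    and "cop_inv (V\<^sub>p z) = cop_inv \<delta>\<^sub>p - z *\<^sub>C (cop_inv \<delta>\<^sub>p \<cdot> \<gamma>' \<cdot>
      cop_inv (cop_id - z *\<^sub>C alpha_circ_plus \<delta> \<alpha>\<^sub>p \<beta>\<^sub>p \<gamma>\<^sub>p \<gamma>\<^sub>m Q) \<cdot> \<beta>\<^sub>p \<cdot> cop_inv \<delta>\<^sub>p)"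
    if "cop_invertible (cop_id - z *\<^sub>C \<alpha>\<^sub>p)" "cop_invertible (V\<^sub>p z)"
    using fac(2)[OF that] by simp_all
  show "cop_invertible (z *\<^sub>C cop_id - alpha_circ_minus \<delta> \<beta>\<^sub>p \<alpha>\<^sub>m \<beta>\<^sub>m \<gamma>\<^sub>m Q)"
    and "cop_inv (V\<^sub>m z) = cop_inv \<delta>\<^sub>m - cop_inv \<delta>\<^sub>m \<cdot> \<gamma>\<^sub>m \<cdot>
      cop_inv (z *\<^sub>C cop_id - alpha_circ_minus \<delta> \<beta>\<^sub>p \<alpha>\<^sub>m \<beta>\<^sub>m \<gamma>\<^sub>m Q) \<cdot> \<beta>' \<cdot> cop_inv \<delta>\<^sub>m"
    if "cop_invertible (z *\<^sub>C cop_id - \<alpha>\<^sub>m)" "cop_invertible (V\<^sub>m z)"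
    using fac(3)[OF that] by simp_all
qed

end
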